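(* Let $(X,d,\mu)$ be a metric measure space, where $\mu$ is a nontrivial Borel regular measure that is finite on bounded sets and positive on nonempty open sets. Let $\mathcal{B}$ be a quasi-Banach function lattice on $X$ such that $\mathcal{B}\subset L^1_{\mathrm{loc}}(X)$. Then $M^1\mathcal{B}(X)\hookrightarrow N^1\mathcal{B}(X)$ and $\dot M^1\mathcal{B}(X)\hookrightarrow\dot N^1\mathcal{B}(X)$, where $\hookrightarrow$ denotes continuous embedding.
   Context: Quasi-Banach function lattice: a quasi-Banach space $\mathcal{B}$ of real-valued measurable functions on $X$ (a vector space with a quasi-norm $\|\cdot\|_{\mathcal{B}}$, complete in the sense of the Riesz–Fischer property; functions equal a.e. are not distinguished) such that if $f\in\mathcal{B}$ and $|g|\le|f|$ almost everywhere, then $g\in\mathcal{B}$ and $\|g\|_{\mathcal{B}}\le\|f\|_{\mathcal{B}}$. Gradients may take the value $\infty$; membership in $\mathcal{B}$ is understood up to modification on null sets. $L^1_{\mathrm{loc}}(X)$ denotes the locally integrable functions on $X$. Hajłasz gradient: a non-negative measurable $g$ is a Hajłasz gradient of a measurable $u$ if there is $E\subset X$ with $\mu(E)=0$ such that $|u(x)-u(y)|\le d(x,y)[g(x)+g(y)]$ for all $x,y\in X\setminus E$. Upper gradient: a non-negative Borel function $g:X\to[0,\infty]$ is an upper gradient of a (pointwise defined) measurable $u$ if $|u(\gamma(a))-u(\gamma(b))|\le\int_\gamma g(s)\,ds$ for every non-constant rectifiable curve (continuous map of finite length) $\gamma:[a,b]\to X$, the integral being with respect to arc length. $M^1\mathcal{B}(X)$: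 all measurable $u\in\mathcal{B}$ having a Hajłasz gradient $g\in\mathcal{B}$, with $\|u\|_{M^1\mathcal{B}(X)}:=\|u\|_{\mathcal{B}}+\inf_g\|g\|_{\mathcal{B}}$, infimum over all Hajłasz gradients $g$ of $u$. $\dot M^1\mathcal{B}(X)$: the same with the condition $u\in\mathcal{B}$ replaced by $u\in L^1_{\mathrm{loc}}(X)$ and quasi-norm $\|u\|_{\dot M^1\mathcal{B}(X)}:=\inf_g\|g\|_{\mathcal{B}}$. $N^1\mathcal{B}(X)$: let $\widetilde N^1\mathcal{B}(X)$ be the space of all measurable $u\in\mathcal{B}$ having an upper gradient $g\in\mathcal{B}$, with $\|u\|_{\widetilde N^1\mathcal{B}(X)}:=\|u\|_{\mathcal{B}}+\inf_g\|g\|_{\mathcal{B}}$, infimum over all upper gradients $g$ of $u$; then $N^1\mathcal{B}(X):=\widetilde N^1\mathcal{B}(X)/\sim$ with $u\sim v$ iff $\|u-v\|_{\widetilde N^1\mathcal{B}(X)}=0$. $\dot N^1\mathcal{B}(X)$: the same with $u\in\mathcal{B}$ replaced by $u\in L^1_{\mathrm{loc}}(X)$ and quasi-norm $\|u\|_{\dot N^1\mathcal{B}(X)}:=\inf_g\|g\|_{\mathcal{B}}$. Meaning of the embeddings: there is a constant $C>0$ such that every $u$ in the Hajłasz-type space has a representative $\widetilde u=u$ a.e. that belongs to the Newtonian-type space, with Newtonian-type quasi-norm of $\widetilde u$ at most $C$ times the Hajłasz-type quasi-norm of $u$. *)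

theory Defs
  imports "HOL-Analysis.Analysis"
begin

section \<open>Metric measure spaces\<close>

text \<open>
  A Borel regular (outer) measure is represented by its restriction to the Caratheodory measurable
  sets. This restriction is complete, and \<open>outer_measure_of M\<close> gives back the outer measure, so the
  regularity axiom speaks about arbitrary subsets of the space.
\<close>

locale metric_measure_space = complete_measure M
  for M :: "'a::metric_space measure" +
  assumes space_eq_UNIV: "space M = UNIV"
    and borel_subset: "sets borel \<subseteq> sets M"
    and borel_regular: "\<exists>S\<in>sets borel. A \<subseteq> S \<and> emeasure M S = outer_measure_of M A"
    and nontrivial: "emeasure M UNIV \<noteq> 0"
    and finite_on_bounded: "A \<in> sets M \<Longrightarrow> bounded A \<Longrightarrow> emeasure M A < \<infinity>"
    and positive_on_open: "open U \<Longrightarrow> U \<noteq> {} \<Longrightarrow> 0 < emeasure M U"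

definition locally_integrable :: "'a::metric_space measure \<Rightarrow> ('a \<Rightarrow> real) set" where
  "locally_integrable M = {u \<in> borel_measurable M. \<forall>x. \<exists>r>0. set_integrable M (ball x r) u}"


section \<open>Quasi-Banach function lattices\<close>

text \<open>
  Only the values of the quasi-norm \<open>qn\<close> on the carrier \<open>B\<close> matter. The last axiom says in
  particular that membership and quasi-norm depend only on the a.e. class of a function. The Riesz-Fischer
  property is stated with the constant \<open>K\<close> of the quasi-triangle inequality.
\<close>

locale quasi_banach_function_lattice =
  fixes M :: "'a measure" and B :: "('a \<Rightarrow> real) set" and qn :: "('a \<Rightarrow> real) \<Rightarrow> real"
  assumes measurable: "f \<in> B \<Longrightarrow> f \<in> borel_measurable M"
    and zero_mem: "(\<lambda>x. 0) \<in> B"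
    and add_mem: "f \<in> B \<Longrightarrow> g \<in> B \<Longrightarrow> (\<lambda>x. f x + g x) \<in> B"
    and scale_mem: "f \<in> B \<Longrightarrow> (\<lambda>x. c * f x) \<in> B"
    and qn_nonneg: "f \<in> B \<Longrightarrow> 0 \<le> qn f"
    and qn_eq_0_iff: "f \<in> B \<Longrightarrow> qn f = 0 \<longleftrightarrow> (AE x in M. f x = 0)"
    and qn_scale: "f \<in> B \<Longrightarrow> qn (\<lambda>x. c * f x) = \<bar>c\<bar> * qn f"
    and quasi_triangle_riesz_fischer:
      "\<exists>K\<ge>1. (\<forall>f\<in>B. \<forall>g\<in>B. qn (\<lambda>x. f x + g x) \<le> K * (qn f + qn g)) \<and>
        (\<forall>F :: nat \<Rightarrow> 'a \<Rightarrow> real. (\<forall>n. F n \<in> B) \<and> summable (\<lambda>n. K ^ n * qn (F n)) \<longrightarrow>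
          (\<exists>h\<in>B. (\<lambda>n. qn (\<lambda>x. h x - (\<Sum>k<n. F k x))) \<longlonglongrightarrow> 0))"
    and lattice: "f \<in> B \<Longrightarrow> g \<in> borel_measurable M \<Longrightarrow> (AE x in M. \<bar>g x\<bar> \<le> \<bar>f x\<bar>) \<Longrightarrow>
      g \<in> B \<and> qn g \<le> qn f"

text \<open>
  Gradients are \<open>[0,\<infinity>]\<close>-valued, while the elements of \<open>B\<close> are real-valued. A gradient belongs to \<open>B\<close>
  if it is finite a.e. and its real-valued modification \<open>enn2real \<circ> g\<close>, which is zero where \<open>g = \<infinity>\<close>,
  is in \<open>B\<close>.
\<close>

definition grad_mem :: "'a measure \<Rightarrow> ('a \<Rightarrow> real) set \<Rightarrow> ('a \<Rightarrow> ennreal) \<Rightarrow> bool" where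
  "grad_mem M B g \<longleftrightarrow> (AE x in M. g x < \<infinity>) \<and> (\<lambda>x. enn2real (g x)) \<in> B"

definition grad_norm :: "(('a \<Rightarrow> real) \<Rightarrow> real) \<Rightarrow> ('a \<Rightarrow> ennreal) \<Rightarrow> real" where
  "grad_norm qn g = qn (\<lambda>x. enn2real (g x))"


section \<open>Curves and arc length\<close>

definition curve_length :: "(real \<Rightarrow> 'a::metric_space) \<Rightarrow> real \<Rightarrow> real \<Rightarrow> ennreal" where
  "curve_length \<gamma> a b =
    (SUP ts \<in> {ts. sorted ts \<and> set ts \<subseteq> {a..b}}.
      \<Sum>i<length ts - 1. ennreal (dist (\<gamma> (ts ! i)) (\<gamma> (ts ! Suc i))))"

definition rectifiable_curve :: "(real \<Rightarrow> 'a::metric_space) \<Rightarrow> real \<Rightarrow> real \<Rightarrow> bool" where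
  "rectifiable_curve \<gamma> a b \<longleftrightarrow>
    a \<le> b \<and> continuous_on {a..b} \<gamma> \<and> curve_length \<gamma> a b < \<infinity>"

text \<open>
  The choice is immaterial: if \<open>\<gamma>\<close> has the same length on \<open>[a,t]\<close> and on \<open>[a,t']\<close>, then \<open>\<gamma> t = \<gamma> t'\<close>.
\<close>

definition arclength_param :: "(real \<Rightarrow> 'a::metric_space) \<Rightarrow> real \<Rightarrow> real \<Rightarrow> real \<Rightarrow> 'a" where
  "arclength_param \<gamma> a b s = \<gamma> (SOME t. t \<in> {a..b} \<and> curve_length \<gamma> a t = ennreal s)"

definition curve_integral :: "('a::metric_space \<Rightarrow> ennreal) \<Rightarrow> (real \<Rightarrow> 'a) \<Rightarrow> real \<Rightarrow> real \<Rightarrow> ennreal" where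
  "curve_integral g \<gamma> a b =
    (\<integral>\<^sup>+s\<in>{0..enn2real (curve_length \<gamma> a b)}. g (arclength_param \<gamma> a b s) \<partial>lborel)"


section \<open>Gradients\<close>

definition hajlasz_gradient ::
    "'a::metric_space measure \<Rightarrow> ('a \<Rightarrow> ennreal) \<Rightarrow> ('a \<Rightarrow> real) \<Rightarrow> bool" where
  "hajlasz_gradient M g u \<longleftrightarrow> g \<in> borel_measurable M \<and>
    (\<exists>E\<in>null_sets M. \<forall>x\<in>-E. \<forall>y\<in>-E.
      ennreal \<bar>u x - u y\<bar> \<le> ennreal (dist x y) * (g x + g y))"

definition upper_gradient :: "('a::metric_space \<Rightarrow> ennreal) \<Rightarrow> ('a \<Rightarrow> real) \<Rightarrow> bool" where
  "upper_gradient g u \<longleftrightarrow> g \<in> borel_measurable borel \<and>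
    (\<forall>\<gamma> a b. rectifiable_curve \<gamma> a b \<and> \<not> \<gamma> constant_on {a..b} \<longrightarrow>
      ennreal \<bar>u (\<gamma> a) - u (\<gamma> b)\<bar> \<le> curve_integral g \<gamma> a b)"

definition hajlasz_gradients ::
    "'a::metric_space measure \<Rightarrow> ('a \<Rightarrow> real) set \<Rightarrow> ('a \<Rightarrow> real) \<Rightarrow> ('a \<Rightarrow> ennreal) set" where
  "hajlasz_gradients M B u = {g. hajlasz_gradient M g u \<and> grad_mem M B g}"

definition upper_gradients ::
    "'a::metric_space measure \<Rightarrow> ('a \<Rightarrow> real) set \<Rightarrow> ('a \<Rightarrow> real) \<Rightarrow> ('a \<Rightarrow> ennreal) set" where
  "upper_gradients M B u = {g. upper_gradient g u \<and> grad_mem M B g}"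


section \<open>Function spaces\<close>

text \<open>
  The infima are over gradients in \<open>B\<close>, the others having infinite norm. They are taken in the reals,
  so the norms are meaningful only on the respective spaces, where the set of gradients is nonempty.
\<close>

definition hajlasz_space :: "'a::metric_space measure \<Rightarrow> ('a \<Rightarrow> real) set \<Rightarrow> ('a \<Rightarrow> real) set" where
  "hajlasz_space M B = {u \<in> B. hajlasz_gradients M B u \<noteq> {}}"

definition hom_hajlasz_space :: "'a::metric_space measure \<Rightarrow> ('a \<Rightarrow> real) set \<Rightarrow> ('a \<Rightarrow> real) set" where
  "hom_hajlasz_space M B = {u \<in> locally_integrable M. hajlasz_gradients M B u \<noteq> {}}"

definition hom_hajlasz_norm ::
    "'a::metric_space measure \<Rightarrow> ('a \<Rightarrow> real) set \<Rightarrow> (('a \<Rightarrow> real) \<Rightarrow> real) \<Rightarrow> ('a \<Rightarrow> real) \<Rightarrow> real" where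
  "hom_hajlasz_norm M B qn u = (INF g\<in>hajlasz_gradients M B u. grad_norm qn g)"

definition hajlasz_norm ::
    "'a::metric_space measure \<Rightarrow> ('a \<Rightarrow> real) set \<Rightarrow> (('a \<Rightarrow> real) \<Rightarrow> real) \<Rightarrow> ('a \<Rightarrow> real) \<Rightarrow> real" where
  "hajlasz_norm M B qn u = qn u + hom_hajlasz_norm M B qn u"

definition pre_newton_space :: "'a::metric_space measure \<Rightarrow> ('a \<Rightarrow> real) set \<Rightarrow> ('a \<Rightarrow> real) set" where
  "pre_newton_space M B = {u \<in> B. upper_gradients M B u \<noteq> {}}"

definition hom_pre_newton_space :: "'a::metric_space measure \<Rightarrow> ('a \<Rightarrow> real) set \<Rightarrow> ('a \<Rightarrow> real) set" where
  "hom_pre_newton_space M B = {u \<in> locally_integrable M. upper_gradients M B u \<noteq> {}}"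

definition hom_newton_norm ::
    "'a::metric_space measure \<Rightarrow> ('a \<Rightarrow> real) set \<Rightarrow> (('a \<Rightarrow> real) \<Rightarrow> real) \<Rightarrow> ('a \<Rightarrow> real) \<Rightarrow> real" where
  "hom_newton_norm M B qn u = (INF g\<in>upper_gradients M B u. grad_norm qn g)"

definition newton_norm ::
    "'a::metric_space measure \<Rightarrow> ('a \<Rightarrow> real) set \<Rightarrow> (('a \<Rightarrow> real) \<Rightarrow> real) \<Rightarrow> ('a \<Rightarrow> real) \<Rightarrow> real" where
  "newton_norm M B qn u = qn u + hom_newton_norm M B qn u"

definition newton_rel ::
    "'a::metric_space measure \<Rightarrow> ('a \<Rightarrow> real) set \<Rightarrow> (('a \<Rightarrow> real) \<Rightarrow> real) \<Rightarrow> ('a \<Rightarrow> real) rel" where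
  "newton_rel M B qn = {(u, v). u \<in> pre_newton_space M B \<and> v \<in> pre_newton_space M B \<and>
    newton_norm M B qn (\<lambda>x. u x - v x) = 0}"

definition hom_newton_rel ::
    "'a::metric_space measure \<Rightarrow> ('a \<Rightarrow> real) set \<Rightarrow> (('a \<Rightarrow> real) \<Rightarrow> real) \<Rightarrow> ('a \<Rightarrow> real) rel" where
  "hom_newton_rel M B qn = {(u, v). u \<in> hom_pre_newton_space M B \<and> v \<in> hom_pre_newton_space M B \<and>
    hom_newton_norm M B qn (\<lambda>x. u x - v x) = 0}"

definition newton_space ::
    "'a::metric_space measure \<Rightarrow> ('a \<Rightarrow> real) set \<Rightarrow> (('a \<Rightarrow> real) \<Rightarrow> real) \<Rightarrow> ('a \<Rightarrow> real) set set" where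
  "newton_space M B qn = pre_newton_space M B // newton_rel M B qn"

definition hom_newton_space ::
    "'a::metric_space measure \<Rightarrow> ('a \<Rightarrow> real) set \<Rightarrow> (('a \<Rightarrow> real) \<Rightarrow> real) \<Rightarrow> ('a \<Rightarrow> real) set set" where
  "hom_newton_space M B qn = hom_pre_newton_space M B // hom_newton_rel M B qn"

end

theory Submission
  imports Defs
begin

text \<open>
  Change a Hajlasz gradient on a null set to a Borel function \<open>g\<close> that is \<open>\<infinity>\<close> on the exceptional
  set, so that the Hajlasz inequality holds at all points. Along an arc-length parametrised curve \<open>\<sigma>\<close>
  with \<open>\<integral> g \<circ> \<sigma> < \<infinity>\<close> and end points where \<open>g < \<infinity>\<close>, choosing points at which \<open>g \<circ> \<sigma>\<close> is at most its
  average over short intervals and telescoping gives \<open>\<bar>u x - u y\<bar> \<le> 4 \<integral> g \<circ> \<sigma>\<close>. Hence \<open>u\<close> restricted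
  to \<open>{g < \<infinity>}\<close> is \<open>1\<close>-Lipschitz for the extended pseudometric \<open>inf\<^sub>\<sigma> 4 \<integral> g \<circ> \<sigma>\<close>, and its McShane extension
  is a representative of \<open>u\<close> with upper gradient \<open>4 g\<close>. If the infimum of the gradient norms is \<open>0\<close>,
  then Riesz-Fischer gives gradients tending to \<open>0\<close> a.e., so \<open>u\<close> is constant a.e.
\<close>


section \<open>Arc length\<close>

text \<open>The inner sum of \<open>curve_length\<close>, kept real so that it can vary
  continuously. Truncated subtraction makes it 0 on lists with fewer than two points.\<close>

definition polygonal_length :: "(real \<Rightarrow> 'a::metric_space) \<Rightarrow> real list \<Rightarrow> real" where
  "polygonal_length \<gamma> ts = (\<Sum>i<length ts - 1. dist (\<gamma> (ts ! i)) (\<gamma> (ts ! Suc i)))"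

lemma polygonal_length_nonneg: "0 \<le> polygonal_length \<gamma> ts"
  by (simp add: polygonal_length_def sum_nonneg)

lemma polygonal_length_Cons:
  "polygonal_length \<gamma> (x # xs) =
    (if xs = [] then 0 else dist (\<gamma> x) (\<gamma> (hd xs)) + polygonal_length \<gamma> xs)"
  by (cases xs) (simp_all add: polygonal_length_def sum.lessThan_Suc_shift del: sum.lessThan_Suc)

text \<open>Joining the lists adds at most one segment, from the last point of \<open>xs\<close> to
  the first of \<open>ys\<close>.\<close>

lemma polygonal_length_append:
  "polygonal_length \<gamma> xs + polygonal_length \<gamma> ys \<le> polygonal_length \<gamma> (xs @ ys)"
proof (induction xs)
  case Nil
  then show ?case by (simp add: polygonal_length_def)
next
  case (Cons x xs)
  then show ?case
    using polygonal_length_nonneg[of \<gamma> ys]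
    by (auto simp: polygonal_length_Cons)
qed

lemma curve_length_eq:
  "curve_length \<gamma> a b =
    (SUP ts \<in> {ts. sorted ts \<and> set ts \<subseteq> {a..b}}. ennreal (polygonal_length \<gamma> ts))"
  by (simp add: curve_length_def polygonal_length_def)

lemma polygonal_length_le_curve_length:
  "sorted ts \<Longrightarrow> set ts \<subseteq> {a..b} \<Longrightarrow> ennreal (polygonal_length \<gamma> ts) \<le> curve_length \<gamma> a b"
  unfolding curve_length_eq by (rule SUP_upper) simp

lemma dist_le_curve_length:
  assumes "a \<le> b"
  shows "ennreal (dist (\<gamma> a) (\<gamma> b)) \<le> curve_length \<gamma> a b"
  using polygonal_length_le_curve_length[of "[a, b]" a b \<gamma>] assms
  by (simp add: polygonal_length_def)

lemma curve_length_refl: "curve_length \<gamma> a a = 0"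
proof -
  have "polygonal_length \<gamma> ts = 0" if "set ts \<subseteq> {a..a}" for ts
    unfolding polygonal_length_def
  proof (rule sum.neutral, rule ballI)
    fix i assume "i \<in> {..<length ts - 1}"
    then have "ts ! i \<in> set ts" "ts ! Suc i \<in> set ts" by auto
    with that have "ts ! i = a" "ts ! Suc i = a" by auto
    then show "dist (\<gamma> (ts ! i)) (\<gamma> (ts ! Suc i)) = 0" by simp
  qed
  then have "curve_length \<gamma> a a \<le> 0"
    unfolding curve_length_eq by (intro SUP_least) auto
  then show ?thesis by simp
qed

lemma sorted_map_min: "sorted ts \<Longrightarrow> sorted (map (min t) ts)" for t :: real
  by (auto simp: sorted_iff_nth_mono min_def intro: order_trans)

lemma sorted_map_max: "sorted ts \<Longrightarrow> sorted (map (max t) ts)" for t :: real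
  by (auto simp: sorted_iff_nth_mono max_def intro: order_trans)

text \<open>Truncating a partition at \<open>t\<close> from above and from below splits it without inserting \<open>t\<close>.\<close>

lemma polygonal_length_split:
  assumes "sorted ts"
  shows "polygonal_length \<gamma> ts
    \<le> polygonal_length \<gamma> (map (min t) ts) + polygonal_length \<gamma> (map (max t) ts)"
proof -
  have "dist (\<gamma> x) (\<gamma> y) \<le> dist (\<gamma> (min t x)) (\<gamma> (min t y)) + dist (\<gamma> (max t x)) (\<gamma> (max t y))"
    if "x \<le> y" for x y
    using that dist_triangle[of "\<gamma> x" "\<gamma> y" "\<gamma> t"] by (auto simp: min_def max_def)
  then show ?thesis
    unfolding polygonal_length_def length_map sum.distrib[symmetric]
    using assms by (intro sum_mono) (simp add: sorted_iff_nth_mono)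
qed

text \<open>One inequality truncates each partition at \<open>t\<close>; the other concatenates
  partitions of the two halves and takes the suprema one after the other.\<close>

lemma curve_length_add:
  assumes "a \<le> t" "t \<le> b"
  shows "curve_length \<gamma> a b = curve_length \<gamma> a t + curve_length \<gamma> t b"
proof (rule antisym)
  show "curve_length \<gamma> a b \<le> curve_length \<gamma> a t + curve_length \<gamma> t b"
    unfolding curve_length_eq[of \<gamma> a b]
  proof (rule SUP_least)
    fix ts assume "ts \<in> {ts. sorted ts \<and> set ts \<subseteq> {a..b}}"
    then have ts: "sorted ts" "set ts \<subseteq> {a..b}" by auto
    have "ennreal (polygonal_length \<gamma> ts) \<le> ennreal (polygonal_length \<gamma> (map (min t) ts)) +
        ennreal (polygonal_length \<gamma> (map (max t) ts))"
      by (simp add: ennreal_plus[symmetric] polygonal_length_nonneg polygonal_length_split[OF ts(1)]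
          ennreal_leI del: ennreal_plus)
    also have "\<dots> \<le> curve_length \<gamma> a t + curve_length \<gamma> t b"
      using assms ts
      by (intro add_mono polygonal_length_le_curve_length sorted_map_min sorted_map_max) auto
    finally show "ennreal (polygonal_length \<gamma> ts) \<le> curve_length \<gamma> a t + curve_length \<gamma> t b" .
  qed
next
  let ?A = "{ts. sorted ts \<and> set ts \<subseteq> {a..t}}" and ?B = "{ts. sorted ts \<and> set ts \<subseteq> {t..b}}"
  \<comment> \<open>A summand moves into an \<open>ennreal\<close> supremum only over a nonempty
    index set; the empty partition provides this.\<close>
  have ne: "?A \<noteq> {}" "?B \<noteq> {}"
    by (auto intro!: exI[of _ "[]"])
  have "ennreal (polygonal_length \<gamma> xs) + ennreal (polygonal_length \<gamma> ys) \<le> curve_length \<gamma> a b"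
    if "xs \<in> ?A" "ys \<in> ?B" for xs ys
  proof -
    have "ennreal (polygonal_length \<gamma> xs) + ennreal (polygonal_length \<gamma> ys)
        \<le> ennreal (polygonal_length \<gamma> (xs @ ys))"
      by (simp add: ennreal_plus[symmetric] polygonal_length_nonneg polygonal_length_append
          ennreal_leI del: ennreal_plus)
    also have "\<dots> \<le> curve_length \<gamma> a b"
      using that assms
      by (intro polygonal_length_le_curve_length) (fastforce simp: sorted_append)+
    finally show ?thesis .
  qed
  then have "curve_length \<gamma> a t + ennreal (polygonal_length \<gamma> ys) \<le> curve_length \<gamma> a b"
    if "ys \<in> ?B" for ys
    unfolding curve_length_eq[of \<gamma> a t] ennreal_SUP_add_left[OF ne(1), symmetric]
    using that by (intro SUP_least) blast
  then show "curve_length \<gamma> a t + curve_length \<gamma> t b \<le> curve_length \<gamma> a b"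
    unfolding curve_length_eq[of \<gamma> t b] ennreal_SUP_add_right[OF ne(2)]
    by (intro SUP_least) blast
qed

section \<open>Lower semicontinuity of arc length in the end points\<close>

lemma continuous_on_polygonal_length_map:
  assumes "continuous_on {a..b} \<gamma>"
    and "\<And>x. x \<in> set ts \<Longrightarrow> continuous_on S (\<lambda>t. f t x)"
    and "\<And>x t. x \<in> set ts \<Longrightarrow> t \<in> S \<Longrightarrow> f t x \<in> {a..b}"
  shows "continuous_on S (\<lambda>t. polygonal_length \<gamma> (map (f t) ts))"
proof -
  have "continuous_on S (\<lambda>t. \<gamma> (f t x))" if "x \<in> set ts" for x
    using assms that by (intro continuous_on_compose2[OF assms(1)]) auto
  then show ?thesis
    unfolding polygonal_length_def length_map
    by (intro continuous_on_sum continuous_on_dist) simp_all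
qed

text \<open>A supremum exceeds \<open>c\<close> iff some member does, so the set is a union of open
  preimages. Openness is relative to \<open>S\<close> because curves are continuous only on their
  parameter interval.\<close>

lemma openin_greaterThan_if_SUP:
  fixes f :: "'i \<Rightarrow> 'b::topological_space \<Rightarrow> real"
  assumes "\<And>i. i \<in> I \<Longrightarrow> continuous_on S (f i)"
    and "\<And>t. t \<in> S \<Longrightarrow> F t = (SUP i\<in>I. ennreal (f i t))"
  shows "openin (top_of_set S) {t \<in> S. c < F t}"
proof -
  have "{t \<in> S. c < F t} = (\<Union>i\<in>I. {t \<in> S. c < ennreal (f i t)})"
    using assms(2) by (auto simp: less_SUP_iff)
  moreover have "openin (top_of_set S) {t \<in> S. c < ennreal (f i t)}" if "i \<in> I" for i
  proof -
    have "continuous_on S (\<lambda>t. ennreal (f i t))"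
      using assms(1)[OF that] by (rule continuous_on_ennreal)
    then have "openin (top_of_set S) (S \<inter> (\<lambda>t. ennreal (f i t)) -` {c<..})"
      by (rule continuous_openin_preimage_gen) simp
    then show ?thesis by (simp add: vimage_def Int_def)
  qed
  ultimately show ?thesis by auto
qed

text \<open>The partitions of \<open>{a..t}\<close> change with \<open>t\<close>. Truncating those
  of \<open>{a..b}\<close> by \<open>min t\<close> yields the same supremum over a fixed index set,
  with members continuous in \<open>t\<close>.\<close>

lemma openin_curve_length_left:
  assumes "continuous_on {a..b} \<gamma>"
  shows "openin (top_of_set {a..b}) {t \<in> {a..b}. c < curve_length \<gamma> a t}"
proof (rule openin_greaterThan_if_SUP)
  let ?I = "{ts. sorted ts \<and> set ts \<subseteq> {a..b}}"
  show "continuous_on {a..b} (\<lambda>t. polygonal_length \<gamma> (map (min t) ts))" if "ts \<in> ?I" for ts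
    using that
    by (intro continuous_on_polygonal_length_map[OF assms]) (auto intro!: continuous_intros)
  show "curve_length \<gamma> a t = (SUP ts\<in>?I. ennreal (polygonal_length \<gamma> (map (min t) ts)))"
    if "t \<in> {a..b}" for t
    unfolding curve_length_eq
  proof (rule antisym; rule SUP_mono)
    fix ts assume ts: "ts \<in> {ts. sorted ts \<and> set ts \<subseteq> {a..t}}"
    then have "map (min t) ts = ts" by (intro map_idI) auto
    with ts that show "\<exists>m\<in>?I. ennreal (polygonal_length \<gamma> ts)
        \<le> ennreal (polygonal_length \<gamma> (map (min t) m))"
      by (intro bexI[of _ ts]) auto
  next
    fix ts assume "ts \<in> ?I"
    with that show "\<exists>m\<in>{ts. sorted ts \<and> set ts \<subseteq> {a..t}}.
        ennreal (polygonal_length \<gamma> (map (min t) ts)) \<le> ennreal (polygonal_length \<gamma> m)"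
      by (intro bexI[of _ "map (min t) ts"]) (auto simp: sorted_map_min)
  qed
qed

lemma openin_curve_length_right:
  assumes "continuous_on {a..b} \<gamma>"
  shows "openin (top_of_set {a..b}) {t \<in> {a..b}. c < curve_length \<gamma> t b}"
proof (rule openin_greaterThan_if_SUP)
  let ?I = "{ts. sorted ts \<and> set ts \<subseteq> {a..b}}"
  show "continuous_on {a..b} (\<lambda>t. polygonal_length \<gamma> (map (max t) ts))" if "ts \<in> ?I" for ts
    using that
    by (intro continuous_on_polygonal_length_map[OF assms]) (auto intro!: continuous_intros)
  show "curve_length \<gamma> t b = (SUP ts\<in>?I. ennreal (polygonal_length \<gamma> (map (max t) ts)))"
    if "t \<in> {a..b}" for t
    unfolding curve_length_eq
  proof (rule antisym; rule SUP_mono)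
    fix ts assume ts: "ts \<in> {ts. sorted ts \<and> set ts \<subseteq> {t..b}}"
    then have "map (max t) ts = ts" by (intro map_idI) auto
    with ts that show "\<exists>m\<in>?I. ennreal (polygonal_length \<gamma> ts)
        \<le> ennreal (polygonal_length \<gamma> (map (max t) m))"
      by (intro bexI[of _ ts]) auto
  next
    fix ts assume "ts \<in> ?I"
    with that show "\<exists>m\<in>{ts. sorted ts \<and> set ts \<subseteq> {t..b}}.
        ennreal (polygonal_length \<gamma> (map (max t) ts)) \<le> ennreal (polygonal_length \<gamma> m)"
      by (intro bexI[of _ "map (max t) ts"]) (auto simp: sorted_map_max)
  qed
qed

text \<open>
  Both \<open>curve_length \<gamma> a t\<close> and \<open>curve_length \<gamma> t b\<close> are lower semicontinuous in \<open>t\<close>, and their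
  sum is constant.
\<close>

lemma curve_length_surj:
  assumes "rectifiable_curve \<gamma> a b" and "0 \<le> s" and "ennreal s \<le> curve_length \<gamma> a b"
  shows "\<exists>t\<in>{a..b}. curve_length \<gamma> a t = ennreal s"
proof (rule ccontr)
  assume contra: "\<not> ?thesis"
  let ?L = "curve_length \<gamma> a b"
  have ab: "a \<le> b" and cont: "continuous_on {a..b} \<gamma>" and fin: "?L < \<infinity>"
    using assms(1) by (auto simp: rectifiable_curve_def)
  have add: "curve_length \<gamma> a t + curve_length \<gamma> t b = ?L" if "t \<in> {a..b}" for t
    using curve_length_add[of a t b \<gamma>] that by simp
  \<comment> \<open>If no parameter has initial length \<open>s\<close>, then \<open>A\<close> and
    \<open>C\<close> are complementary relatively open subsets of the connected interval.\<close>
  define A where "A = {t \<in> {a..b}. ennreal s < curve_length \<gamma> a t}"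
  define C where "C = {t \<in> {a..b}. ?L - ennreal s < curve_length \<gamma> t b}"
  have s_L: "ennreal s + (?L - ennreal s) = ?L"
    using assms(3) by (simp add: add_diff_inverse_ennreal)
  have split: "t \<in> A \<longleftrightarrow> t \<notin> C" if "t \<in> {a..b}" for t
  proof
    assume "t \<in> A"
    then have "ennreal s < curve_length \<gamma> a t" by (simp add: A_def)
    show "t \<notin> C"
    proof
      assume "t \<in> C"
      then have "?L - ennreal s < curve_length \<gamma> t b" by (simp add: C_def)
      with \<open>ennreal s < curve_length \<gamma> a t\<close>
      have "ennreal s + (?L - ennreal s) < curve_length \<gamma> a t + curve_length \<gamma> t b"
        by (rule add_strict_mono)
      then show False using add[OF that] s_L by simp
    qed
  next
    assume "t \<notin> C"
    then have 1: "curve_length \<gamma> t b \<le> ?L - ennreal s" using that by (auto simp: C_def)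
    show "t \<in> A"
    proof (rule ccontr)
      assume "t \<notin> A"
      with contra that have "curve_length \<gamma> a t < ennreal s"
        by (force simp: A_def not_less order_le_less)
      \<comment> \<open>Finiteness keeps the inequality strict after the addition, so the two
        lengths would sum to less than \<open>?L\<close>.\<close>
      moreover have "?L - ennreal s \<noteq> \<infinity>" using fin by (simp add: less_top ennreal_minus_eq_top)
      ultimately have "(?L - ennreal s) + curve_length \<gamma> a t < (?L - ennreal s) + ennreal s"
        by (simp add: ennreal_add_left_cancel_less)
      then have "curve_length \<gamma> a t + curve_length \<gamma> t b < ennreal s + (?L - ennreal s)"
        using add_left_mono[OF 1, of "curve_length \<gamma> a t"]
        by (metis add.commute order.strict_trans1)
      then show False using add[OF that] s_L by simp
    qed
  qed
  \<comment> \<open>The initial lengths at \<open>a\<close> and \<open>b\<close> are 0 and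
    \<open>?L\<close>; neither equals \<open>s\<close>, so they lie strictly on either side of
    it.\<close>
  have "a \<in> C" "b \<in> A"
    using contra ab split[of a] assms(3) by (auto simp: A_def curve_length_refl order_le_less)
  moreover have "openin (top_of_set {a..b}) A" "openin (top_of_set {a..b}) C"
    unfolding A_def C_def by (intro openin_curve_length_left openin_curve_length_right cont)+
  moreover have "connected {a..b}" by simp
  moreover have "A \<inter> C = {}" "{a..b} \<subseteq> A \<union> C" "A \<subseteq> {a..b}" "C \<subseteq> {a..b}"
    using split by (auto simp: A_def C_def)
  ultimately show False unfolding connected_openin by blast
qed

section \<open>The arc-length parametrisation\<close>

lemma dist_le_diff_curve_length:
  assumes "rectifiable_curve \<gamma> a b" "t \<in> {a..b}" "t' \<in> {a..b}" "0 \<le> s" "0 \<le> s'"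
    and "curve_length \<gamma> a t = ennreal s" "curve_length \<gamma> a t' = ennreal s'"
  shows "dist (\<gamma> t) (\<gamma> t') \<le> \<bar>s - s'\<bar>"
  using assms
proof (induction t t' arbitrary: s s' rule: linorder_wlog)
  case (le t t')
  \<comment> \<open>The piece between \<open>t\<close> and \<open>t'\<close> is at least as long as
    its chord, and by additivity its length is \<open>s' - s\<close>.\<close>
  have "ennreal s + ennreal (dist (\<gamma> t) (\<gamma> t')) \<le> curve_length \<gamma> a t + curve_length \<gamma> t t'"
    using le by (intro add_mono dist_le_curve_length) auto
  also have "\<dots> = ennreal s'"
    using le curve_length_add[of a t t' \<gamma>] by simp
  finally have "s + dist (\<gamma> t) (\<gamma> t') \<le> s'"
    using le by (simp add: ennreal_plus[symmetric] del: ennreal_plus)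
  then show ?case by simp
next
  case (sym t t')
  show ?case using sym(1)[of s' s] sym(2-) by (simp add: dist_commute abs_minus_commute)
qed

text \<open>By \<open>curve_length_surj\<close> the choice in \<open>arclength_param\<close>
  succeeds on \<open>{0..L}\<close>. Parameters with equal initial length have the same image, so
  any of them computes the value.\<close>

lemma rectifiable_curve_arclength_param:
  assumes "rectifiable_curve \<gamma> a b"
  defines "L \<equiv> enn2real (curve_length \<gamma> a b)"
  shows "1-lipschitz_on {0..L} (arclength_param \<gamma> a b)"
    and "arclength_param \<gamma> a b 0 = \<gamma> a"
    and "arclength_param \<gamma> a b L = \<gamma> b"
proof -
  have ab: "a \<le> b" and fin: "curve_length \<gamma> a b = ennreal L"
    using assms by (auto simp: rectifiable_curve_def)
  have L: "0 \<le> L" by (simp add: L_def)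
  have ex: "\<exists>t. t \<in> {a..b} \<and> curve_length \<gamma> a t = ennreal s \<and> arclength_param \<gamma> a b s = \<gamma> t"
    if "s \<in> {0..L}" for s
  proof -
    have "\<exists>t. t \<in> {a..b} \<and> curve_length \<gamma> a t = ennreal s"
      using curve_length_surj[OF assms(1), of s] that fin by (auto simp: ennreal_leI)
    from someI_ex[OF this] show ?thesis by (auto simp: arclength_param_def)
  qed
  show "1-lipschitz_on {0..L} (arclength_param \<gamma> a b)"
  proof (rule lipschitz_onI)
    fix s s' assume s: "s \<in> {0..L}" "s' \<in> {0..L}"
    with ex[of s] ex[of s'] obtain t t' where
      "t \<in> {a..b}" "curve_length \<gamma> a t = ennreal s" "arclength_param \<gamma> a b s = \<gamma> t"
      "t' \<in> {a..b}" "curve_length \<gamma> a t' = ennreal s'" "arclength_param \<gamma> a b s' = \<gamma> t'"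
      by blast
    with dist_le_diff_curve_length[OF assms(1)] s
    show "dist (arclength_param \<gamma> a b s) (arclength_param \<gamma> a b s') \<le> 1 * dist s s'"
      by (simp add: dist_real_def)
  qed simp
  have eq: "arclength_param \<gamma> a b s = \<gamma> t"
    if t: "t \<in> {a..b}" "curve_length \<gamma> a t = ennreal s" and s: "s \<in> {0..L}" for s t
  proof -
    obtain t' where
      "t' \<in> {a..b}" "curve_length \<gamma> a t' = ennreal s" "arclength_param \<gamma> a b s = \<gamma> t'"
      using ex[OF s] by blast
    then show ?thesis
      using dist_le_diff_curve_length[OF assms(1), of t' t s s] t s by simp
  qed
  show "arclength_param \<gamma> a b 0 = \<gamma> a"
    using ab L by (intro eq) (auto simp: curve_length_refl)
  show "arclength_param \<gamma> a b L = \<gamma> b"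
    using ab L fin by (intro eq) auto
qed

section \<open>Hajlasz inequalities on an interval\<close>

text \<open>Otherwise \<open>h\<close> exceeds its average on the whole interval, and integration
  gives a number smaller than itself. Half-open intervals are used because adjacent ones are
  disjoint.\<close>

lemma exists_mult_le_nn_integral:
  fixes h :: "real \<Rightarrow> ennreal"
  assumes [measurable]: "h \<in> borel_measurable borel" and d: "0 < d"
    and fin: "(\<integral>\<^sup>+s\<in>{c..<c + d}. h s \<partial>lborel) < \<infinity>"
  shows "\<exists>t\<in>{c..<c + d}. ennreal d * h t \<le> (\<integral>\<^sup>+s\<in>{c..<c + d}. h s \<partial>lborel)"
proof (rule ccontr)
  let ?I = "{c..<c + d}"
  let ?N = "\<integral>\<^sup>+s\<in>?I. h s \<partial>lborel"
  assume "\<not> ?thesis"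
  then have less: "?N < ennreal d * h t" if "t \<in> ?I" for t
    using that by (auto simp: not_le)
  have c: "(\<integral>\<^sup>+s. ?N * indicator ?I s \<partial>lborel) = ?N * ennreal d"
    using d by (subst nn_integral_cmult_indicator) auto
  have "(\<integral>\<^sup>+s. ?N * indicator ?I s \<partial>lborel) < (\<integral>\<^sup>+s. ennreal d * (h s * indicator ?I s) \<partial>lborel)"
  proof (rule nn_integral_less)
    show "(\<integral>\<^sup>+s. ?N * indicator ?I s \<partial>lborel) \<noteq> \<infinity>"
      using fin c by (simp add: ennreal_mult_eq_top_iff)
    show "AE s in lborel. ?N * indicator ?I s \<le> ennreal d * (h s * indicator ?I s)"
      using less by (intro AE_I2) (auto simp: indicator_def less_imp_le)
    \<comment> \<open>Strictness must hold on a non-null set; it holds on all of \<open>?I\<close>,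
      which has measure \<open>d\<close>.\<close>
    show "\<not> (AE s in lborel. ennreal d * (h s * indicator ?I s) \<le> ?N * indicator ?I s)"
    proof
      assume "AE s in lborel. ennreal d * (h s * indicator ?I s) \<le> ?N * indicator ?I s"
      then have "AE s in lborel. s \<notin> ?I"
        using less by (elim AE_mp, intro AE_I2) (force simp: indicator_def)
      then have "emeasure lborel ?I = 0"
        by (subst (asm) AE_iff_measurable[of ?I]) auto
      with d show False by simp
    qed
  qed measurable
  also have "\<dots> = ennreal d * ?N" by (rule nn_integral_cmult) measurable
  finally show False using c by (simp add: mult.commute)
qed

lemma nn_integral_Ico_add:
  fixes h :: "real \<Rightarrow> ennreal"
  assumes [measurable]: "h \<in> borel_measurable borel" and "a \<le> b" "b \<le> c"
  shows "(\<integral>\<^sup>+s\<in>{a..<c}. h s \<partial>lborel) =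
    (\<integral>\<^sup>+s\<in>{a..<b}. h s \<partial>lborel) + (\<integral>\<^sup>+s\<in>{b..<c}. h s \<partial>lborel)"
proof -
  have "{a..<c} = {a..<b} \<union> {b..<c}" using assms by auto
  then show ?thesis by (simp add: nn_integral_disjoint_pair)
qed

lemma le_if_le_const_divide_Suc_add:
  fixes a c D :: real
  assumes "\<And>n::nat. a \<le> c / Suc n + D"
  shows "a \<le> D"
proof (rule LIMSEQ_le_const)
  have "(\<lambda>n. c / real (Suc n) + D) \<longlonglongrightarrow> 0 + D"
    by (intro tendsto_add tendsto_const LIMSEQ_Suc lim_const_over_n)
  then show "(\<lambda>n. c / real (Suc n) + D) \<longlonglongrightarrow> D" by simp
qed (use assms in auto)

text \<open>
  Cut \<open>[p, q]\<close> into intervals \<open>I\<^sub>0, \<dots>, I\<^sub>n\<close> of length \<open>\<delta>\<close>, choose \<open>t\<^sub>i \<in> I\<^sub>i\<close> with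
  \<open>\<delta> h(t\<^sub>i) \<le> \<integral>\<^bsub>I\<^sub>i\<^esub> h\<close> and telescope; the end points contribute \<open>\<delta> (h(p) + h(q)) \<rightarrow> 0\<close>.
\<close>

lemma dist_le_nn_integral_if_hajlasz:
  fixes w :: "real \<Rightarrow> real" and h :: "real \<Rightarrow> ennreal"
  assumes "p \<le> q" and h[measurable]: "h \<in> borel_measurable borel"
    and w: "\<And>s t. s \<in> {p..q} \<Longrightarrow> t \<in> {p..q} \<Longrightarrow>
      ennreal \<bar>w s - w t\<bar> \<le> ennreal \<bar>s - t\<bar> * (h s + h t)"
    and hp: "h p < \<infinity>" and hq: "h q < \<infinity>"
  shows "ennreal \<bar>w p - w q\<bar> \<le> 4 * (\<integral>\<^sup>+s\<in>{p..q}. h s \<partial>lborel)"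
proof -
  define N where "N S = (\<integral>\<^sup>+s\<in>S. h s \<partial>lborel)" for S
  show ?thesis
  \<comment> \<open>The left side is 0 if \<open>p = q\<close>, and the right side is infinite if
    the integral is.\<close>
  proof (cases "p = q \<or> N {p..q} = \<infinity>")
    case True
    then show ?thesis by (auto simp: N_def ennreal_mult_top)
  next
    case False
    then have pq: "p < q" and fin: "N {p..q} < \<infinity>"
      using \<open>p \<le> q\<close> by (auto simp: less_top)
    have N_mono: "N S \<le> N T" if "S \<subseteq> T" for S T
      unfolding N_def using that by (intro nn_integral_mono) (auto simp: indicator_def)
    define D where "D = enn2real (N {p..q})"
    have D: "N {p..q} = ennreal D" using fin by (simp add: D_def)
    define P where "P = enn2real (h p)"
    have P: "h p = ennreal P" using hp by (simp add: P_def)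
    define Q where "Q = enn2real (h q)"
    have Q: "h q = ennreal Q" using hq by (simp add: Q_def)
    have nonneg: "0 \<le> D" "0 \<le> P" "0 \<le> Q" by (simp_all add: D_def P_def Q_def)
    \<comment> \<open>The finite values at the end points enter with weight
      \<open>(q - p) / Suc n\<close>, which vanishes as \<open>n\<close> grows.\<close>
    have "\<bar>w p - w q\<bar> \<le> (q - p) * (P + Q) / Suc n + 4 * D" for n
    proof -
      define d where "d = (q - p) / Suc n"
      have d: "0 < d" using pq by (simp add: d_def)
      have q_eq: "q = p + Suc n * d" by (simp add: d_def)
      define c where "c i = p + real i * d" for i :: nat
      define I where "I i = {c i..<c i + d}" for i
      have c_Suc: "c i + d = c (Suc i)" for i by (simp add: c_def algebra_simps)
      have c_le: "c i \<le> q" if "i \<le> Suc n" for i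
        unfolding c_def q_eq using that d by simp
      have c_ge: "p \<le> c i" for i using d by (simp add: c_def)
      have I_sub: "I i \<subseteq> {p..q}" if "i \<le> n" for i
        using c_le[of "Suc i"] c_ge[of i] that unfolding I_def c_Suc by auto
      have "\<exists>t. t \<in> I i \<and> ennreal d * h t \<le> N (I i)" if "i \<le> n" for i
        using exists_mult_le_nn_integral[OF h d, of "c i"] fin N_mono[OF I_sub[OF that]]
        unfolding N_def I_def by (meson order.strict_trans1)
      then obtain t where t: "\<And>i. i \<le> n \<Longrightarrow> t i \<in> I i"
        and ht: "\<And>i. i \<le> n \<Longrightarrow> ennreal d * h (t i) \<le> N (I i)"
        by metis
      have t_pq: "t i \<in> {p..q}" if "i \<le> n" for i using t I_sub that by blast
      have w_near: "ennreal \<bar>w x - w y\<bar> \<le> ennreal d * h x + ennreal d * h y"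
        if "\<bar>x - y\<bar> \<le> d" "x \<in> {p..q}" "y \<in> {p..q}" for x y
      proof -
        have "ennreal \<bar>w x - w y\<bar> \<le> ennreal \<bar>x - y\<bar> * (h x + h y)" using that by (intro w)
        also have "\<dots> \<le> ennreal d * (h x + h y)" using that by (intro mult_right_mono ennreal_leI) auto
        finally show ?thesis by (simp add: distrib_left)
      qed
      have tri: "ennreal \<bar>x - z\<bar> \<le> ennreal \<bar>x - y\<bar> + ennreal \<bar>y - z\<bar>" for x y z :: real
        by (simp add: ennreal_plus[symmetric] ennreal_leI del: ennreal_plus)
      \<comment> \<open>Origin of the constant 4: a jump costs
        \<open>2 * (N (I i) + N (I (Suc i)))\<close>, so an interval pays 2 when it is entered and 2
        when it is left. The last one has paid only 2 so far.\<close>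
      have "ennreal \<bar>w p - w (t i)\<bar> \<le> ennreal d * h p + 4 * N {p..<c i} + 2 * N (I i)" if "i \<le> n" for i
        using that
      proof (induction i)
        case 0
        have "ennreal \<bar>w p - w (t 0)\<bar> \<le> ennreal d * h p + ennreal d * h (t 0)"
          using t[of 0] t_pq[of 0] pq by (intro w_near) (auto simp: I_def c_def)
        also have "\<dots> \<le> ennreal d * h p + 2 * N (I 0)"
          using ht[of 0] by (intro add_left_mono) (auto simp: mult_2 intro: add_increasing)
        finally show ?case by (simp add: c_def N_def)
      next
        case (Suc i)
        let ?t = "t (Suc i)"
        \<comment> \<open>Points of adjacent intervals of length \<open>d\<close>.\<close>
        have "\<bar>t i - ?t\<bar> \<le> 2 * d"
          using t[of i] t[of "Suc i"] Suc.prems c_Suc[of i] unfolding I_def by auto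
        have "ennreal \<bar>w (t i) - w ?t\<bar> \<le> ennreal \<bar>t i - ?t\<bar> * (h (t i) + h ?t)"
          using Suc.prems by (intro w t_pq) auto
        also have "\<dots> \<le> ennreal (2 * d) * (h (t i) + h ?t)"
          using \<open>\<bar>t i - ?t\<bar> \<le> 2 * d\<close> by (intro mult_right_mono ennreal_leI) auto
        also have "\<dots> = 2 * (ennreal d * h (t i) + ennreal d * h ?t)"
          using d by (simp add: ennreal_mult algebra_simps)
        also have "\<dots> \<le> 2 * (N (I i) + N (I (Suc i)))"
          using Suc.prems by (intro mult_left_mono add_mono ht) auto
        finally have step: "ennreal \<bar>w (t i) - w ?t\<bar> \<le> 2 * (N (I i) + N (I (Suc i)))" .
        have N_Suc: "N {p..<c (Suc i)} = N {p..<c i} + N (I i)"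
          unfolding N_def I_def c_Suc using c_ge c_Suc[of i] d
          by (intro nn_integral_Ico_add h) auto
        have "ennreal \<bar>w p - w ?t\<bar> \<le> ennreal \<bar>w p - w (t i)\<bar> + ennreal \<bar>w (t i) - w ?t\<bar>"
          by (rule tri)
        also have "\<dots> \<le> (ennreal d * h p + 4 * N {p..<c i} + 2 * N (I i)) +
            2 * (N (I i) + N (I (Suc i)))"
          using Suc by (intro add_mono step) auto
        also have "\<dots> = ennreal d * h p + 4 * N {p..<c (Suc i)} + 2 * N (I (Suc i))"
        proof -
          have "2 * x + 2 * x = 4 * x" for x :: ennreal
            by (simp add: distrib_right[symmetric])
          then show ?thesis
            unfolding N_Suc by (simp add: distrib_left add_ac)
        qed
        finally show ?case .
      qed
      note this[of n]
      \<comment> \<open>\<open>q\<close> is the right end of \<open>I n\<close>, so this jump has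
        length at most \<open>d\<close> and raises the weight of \<open>I n\<close> only from 2 to
        3.\<close>
      moreover have "ennreal \<bar>w (t n) - w q\<bar> \<le> ennreal d * h (t n) + ennreal d * h q"
        using t[of n] t_pq[of n] pq q_eq c_Suc[of n] by (intro w_near) (auto simp: I_def c_def)
      moreover have "ennreal d * h (t n) \<le> N (I n)" by (simp add: ht)
      moreover note tri[of "w p" "w q" "w (t n)"]
      ultimately have "ennreal \<bar>w p - w q\<bar> \<le>
          (ennreal d * h p + 4 * N {p..<c n} + 2 * N (I n)) + (N (I n) + ennreal d * h q)"
        by (meson add_mono order_refl order_trans)
      also have "\<dots> = ennreal d * h p + ennreal d * h q + (4 * N {p..<c n} + 3 * N (I n))"
      proof -
        have "2 * x + x = 3 * x" for x :: ennreal
          using distrib_right[of 2 1 x] by simp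
        then show ?thesis by (simp add: add_ac)
      qed
      also have "\<dots> \<le> ennreal d * h p + ennreal d * h q + 4 * (N {p..<c n} + N (I n))"
        unfolding distrib_left by (intro add_mono order_refl mult_right_mono) auto
      also have "N {p..<c n} + N (I n) = N {p..<q}"
        unfolding N_def I_def c_Suc using c_ge c_Suc[of n] d q_eq
        by (subst nn_integral_Ico_add[symmetric]) (auto simp: c_def)
      also have "ennreal d * h p + ennreal d * h q + 4 * N {p..<q}
          \<le> ennreal d * h p + ennreal d * h q + 4 * N {p..q}"
        by (intro add_left_mono mult_left_mono N_mono) auto
      also have "\<dots> = ennreal (d * P + d * Q + 4 * D)"
        using d nonneg unfolding P Q D by (simp add: ennreal_mult ennreal_plus)
      finally have "\<bar>w p - w q\<bar> \<le> d * P + d * Q + 4 * D"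
        using d nonneg by (subst (asm) ennreal_le_iff) auto
      moreover have "d * P + d * Q = (q - p) * (P + Q) / Suc n"
        by (simp add: d_def distrib_left add_divide_distrib)
      ultimately show ?thesis by simp
    qed
    then have "\<bar>w p - w q\<bar> \<le> 4 * D" by (rule le_if_le_const_divide_Suc_add)
    then have "ennreal \<bar>w p - w q\<bar> \<le> 4 * ennreal D"
      using nonneg by (metis ennreal_leI ennreal_mult ennreal_numeral zero_le_numeral)
    then show ?thesis by (simp add: D[unfolded N_def])
  qed
qed

section \<open>Extension along arcs\<close>

text \<open>
  McShane extension with respect to the extended pseudometric \<open>\<rho> x y = inf {r. P x y r}\<close>; the relation
  \<open>P\<close> keeps all quantities real.
\<close>

lemma mcshane_extension:
  fixes u :: "'a \<Rightarrow> real" and P :: "'a \<Rightarrow> 'a \<Rightarrow> real \<Rightarrow> bool"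
  assumes nonneg: "\<And>x y r. P x y r \<Longrightarrow> 0 \<le> r"
    and refl: "\<And>x. P x x 0"
    and sym: "\<And>x y r. P x y r \<Longrightarrow> P y x r"
    and trans: "\<And>x y z r s. P x y r \<Longrightarrow> P y z s \<Longrightarrow> P x z (r + s)"
    and u: "\<And>x y r. x \<in> G \<Longrightarrow> y \<in> G \<Longrightarrow> P x y r \<Longrightarrow> \<bar>u x - u y\<bar> \<le> r"
  obtains v where "\<And>x. x \<in> G \<Longrightarrow> v x = u x" and "\<And>x y r. P x y r \<Longrightarrow> \<bar>v x - v y\<bar> \<le> r"
proof
  \<comment> \<open>Candidate lower bounds for the extension. A point unrelated to \<open>G\<close>
    has no candidates and gets the unspecified value \<open>Sup {}\<close>.\<close>
  define S where "S x = {u y - r | y r. y \<in> G \<and> P x y r}" for x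
  define v where "v x = Sup (S x)" for x
  have le: "u y - r \<le> u z + s" if "y \<in> G" "z \<in> G" "P x y r" "P x z s" for x y z r s
    using u[OF that(1,2) trans[OF sym[OF that(3)] that(4)]] by simp
  \<comment> \<open>A single relation \<open>P x z s\<close> with \<open>z\<close> in
    \<open>G\<close> bounds all candidates at \<open>x\<close>: composing it with any other one
    relates two points of \<open>G\<close>.\<close>
  have bdd: "bdd_above (S x)" for x
  proof (cases "S x = {}")
    case False
    then obtain z s where "z \<in> G" "P x z s" by (auto simp: S_def)
    then show ?thesis by (intro bdd_aboveI[of _ "u z + s"]) (auto simp: S_def intro: le)
  qed simp
  show "v x = u x" if "x \<in> G" for x
    unfolding v_def
  proof (rule cSup_eq_maximum)
    show "u x \<in> S x" using that refl[of x] by (force simp: S_def)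
    show "y \<le> u x" if "y \<in> S x" for y
      using that le[OF _ \<open>x \<in> G\<close> _ refl[of x]] by (auto simp: S_def)
  qed
  have v_le: "v x \<le> v y + r" if P: "P x y r" and ne: "S x \<noteq> {}" for x y r
    unfolding v_def[of x]
  proof (rule cSup_least[OF ne])
    fix c assume "c \<in> S x"
    then obtain z s where z: "z \<in> G" "P x z s" "c = u z - s" by (auto simp: S_def)
    then have "u z - (r + s) \<in> S y" using trans[OF sym[OF P]] by (auto simp: S_def)
    then have "u z - (r + s) \<le> v y" unfolding v_def by (rule cSup_upper) (rule bdd)
    with z show "c \<le> v y + r" by simp
  qed
  have ne: "S y \<noteq> {}" if P: "P x y r" and "S x \<noteq> {}" for x y r
    using that(2) trans[OF sym[OF P]] by (fastforce simp: S_def)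
  show "\<bar>v x - v y\<bar> \<le> r" if P: "P x y r" for x y r
  proof (cases "S x = {}")
    \<comment> \<open>Related points are both linked to \<open>G\<close> or both not; in the latter
      case both values are \<open>Sup {}\<close>.\<close>
    case True
    then have "S y = {}" using ne[OF sym[OF P]] by blast
    with True nonneg[OF P] show ?thesis by (simp add: v_def)
  next
    case False
    then show ?thesis using v_le[OF P] v_le[OF sym[OF P]] ne[OF P] by force
  qed
qed

definition arc_le :: "('a::metric_space \<Rightarrow> ennreal) \<Rightarrow> 'a \<Rightarrow> 'a \<Rightarrow> real \<Rightarrow> bool" where
  "arc_le g x y r \<longleftrightarrow> 0 \<le> r \<and> (\<exists>L\<ge>0. \<exists>\<sigma> :: real \<Rightarrow> 'a. 1-lipschitz_on {0..L} \<sigma> \<and> \<sigma> 0 = x \<and> \<sigma> L = y \<and>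
    (\<integral>\<^sup>+s\<in>{0..L}. g (\<sigma> s) \<partial>lborel) \<le> ennreal r)"

text \<open>Nothing is known about \<open>\<sigma>\<close> off the interval, hence the
  indicator.\<close>

lemma borel_measurable_comp_lipschitz:
  fixes g :: "'a::metric_space \<Rightarrow> ennreal" and \<sigma> :: "real \<Rightarrow> 'a"
  assumes "g \<in> borel_measurable borel" "C-lipschitz_on {a..b} \<sigma>"
  shows "(\<lambda>s. g (\<sigma> s) * indicator {a..b} s) \<in> borel_measurable borel"
proof -
  have "\<sigma> \<in> borel_measurable (restrict_space borel {a..b})"
    using assms(2) by (intro borel_measurable_continuous_on_restrict lipschitz_on_continuous_on)
  from measurable_compose[OF this assms(1)] show ?thesis
    by (subst (asm) borel_measurable_restrict_space_iff_ennreal) auto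
qed

lemma arc_leE:
  fixes g :: "'a::metric_space \<Rightarrow> ennreal"
  assumes "arc_le g x y r"
  obtains L :: real and \<sigma> :: "real \<Rightarrow> 'a" where "0 \<le> r" "0 \<le> L" "1-lipschitz_on {0..L} \<sigma>" "\<sigma> 0 = x" "\<sigma> L = y"
    "(\<integral>\<^sup>+s\<in>{0..L}. g (\<sigma> s) \<partial>lborel) \<le> ennreal r"
  using assms unfolding arc_le_def by blast

lemma arc_le_refl: "arc_le g x x 0"
  unfolding arc_le_def
proof (intro conjI exI)
  show "1-lipschitz_on {0..0} (\<lambda>_. x)" by (rule lipschitz_onI) auto
qed simp_all

lemma arc_le_sym:
  fixes g :: "'a::metric_space \<Rightarrow> ennreal"
  assumes g: "g \<in> borel_measurable borel" and "arc_le g x y r"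
  shows "arc_le g y x r"
proof -
  obtain L :: real and \<sigma> :: "real \<Rightarrow> 'a" where r: "0 \<le> r" and L: "0 \<le> L" and lip: "1-lipschitz_on {0..L} \<sigma>"
    and xy: "\<sigma> 0 = x" "\<sigma> L = y" and int: "(\<integral>\<^sup>+s\<in>{0..L}. g (\<sigma> s) \<partial>lborel) \<le> ennreal r"
    using assms(2) by (rule arc_leE)
  \<comment> \<open>Substitution of \<open>L - s\<close> for \<open>s\<close>.\<close>
  have "(\<integral>\<^sup>+s\<in>{0..L}. g (\<sigma> s) \<partial>lborel)
      = (\<integral>\<^sup>+s. g (\<sigma> (L - s)) * indicator {0..L} (L - s) \<partial>lborel)"
    using nn_integral_real_affine[OF borel_measurable_comp_lipschitz[OF g lip], of "-1" L] by simp
  also have "\<dots> = (\<integral>\<^sup>+s\<in>{0..L}. g (\<sigma> (L - s)) \<partial>lborel)"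
    by (intro nn_integral_cong) (auto simp: indicator_def)
  finally have "(\<integral>\<^sup>+s\<in>{0..L}. g (\<sigma> (L - s)) \<partial>lborel) \<le> ennreal r" using int by simp
  moreover have "1-lipschitz_on {0..L} (\<lambda>s. \<sigma> (L - s))"
  proof (rule lipschitz_onI)
    fix s s' assume "s \<in> {0..L}" "s' \<in> {0..L}"
    then show "dist (\<sigma> (L - s)) (\<sigma> (L - s')) \<le> 1 * dist s s'"
      using lipschitz_onD[OF lip, of "L - s" "L - s'"] by (simp add: dist_real_def abs_minus_commute)
  qed simp
  ultimately show ?thesis
    unfolding arc_le_def using r L xy by (intro conjI exI[of _ L] exI[of _ "\<lambda>s. \<sigma> (L - s)"]) auto
qed

lemma arc_le_trans:
  fixes g :: "'a::metric_space \<Rightarrow> ennreal"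
  assumes g: "g \<in> borel_measurable borel" and "arc_le g x y r" "arc_le g y z r'"
  shows "arc_le g x z (r + r')"
proof -
  obtain L :: real and \<sigma> :: "real \<Rightarrow> 'a" where r: "0 \<le> r" and L: "0 \<le> L" and lip: "1-lipschitz_on {0..L} \<sigma>"
    and xy: "\<sigma> 0 = x" "\<sigma> L = y" and int: "(\<integral>\<^sup>+s\<in>{0..L}. g (\<sigma> s) \<partial>lborel) \<le> ennreal r"
    using assms(2) by (rule arc_leE)
  obtain L' :: real and \<sigma>' :: "real \<Rightarrow> 'a" where r': "0 \<le> r'" and L': "0 \<le> L'" and lip': "1-lipschitz_on {0..L'} \<sigma>'"
    and xy': "\<sigma>' 0 = y" "\<sigma>' L' = z" and int': "(\<integral>\<^sup>+s\<in>{0..L'}. g (\<sigma>' s) \<partial>lborel) \<le> ennreal r'"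
    using assms(3) by (rule arc_leE)
  define \<tau> where "\<tau> s = (if s \<le> L then \<sigma> s else \<sigma>' (s - L))" for s
  have shift: "1-lipschitz_on {L..L + L'} (\<lambda>s. \<sigma>' (s - L))"
  proof (rule lipschitz_onI)
    fix s s' assume "s \<in> {L..L + L'}" "s' \<in> {L..L + L'}"
    then show "dist (\<sigma>' (s - L)) (\<sigma>' (s' - L)) \<le> 1 * dist s s'"
      using lipschitz_onD[OF lip', of "s - L" "s' - L"] by (simp add: dist_real_def)
  qed simp
  have lip\<tau>: "1-lipschitz_on {0..L + L'} \<tau>"
    unfolding \<tau>_def using lipschitz_on_concat[OF lip shift] xy xy' by simp
  note meas = borel_measurable_comp_lipschitz[OF g lip]
  note meas' = borel_measurable_comp_lipschitz[OF g lip']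
  \<comment> \<open>Only an inequality, since both indicators are 1 at \<open>s = L\<close>. The
    form \<open>-L + 1 * s\<close> fits the affine substitution below.\<close>
  have "(\<integral>\<^sup>+s\<in>{0..L + L'}. g (\<tau> s) \<partial>lborel) \<le>
      (\<integral>\<^sup>+s. g (\<sigma> s) * indicator {0..L} s + g (\<sigma>' (-L + 1 * s)) * indicator {0..L'} (-L + 1 * s) \<partial>lborel)"
    by (intro nn_integral_mono) (auto simp: \<tau>_def indicator_def)
  also have "\<dots> = (\<integral>\<^sup>+s\<in>{0..L}. g (\<sigma> s) \<partial>lborel)
      + (\<integral>\<^sup>+s. g (\<sigma>' (-L + 1 * s)) * indicator {0..L'} (-L + 1 * s) \<partial>lborel)"
    using meas measurable_compose[OF _ meas', of "\<lambda>s. -L + 1 * s" borel]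
    by (intro nn_integral_add) simp_all
  also have "(\<integral>\<^sup>+s. g (\<sigma>' (-L + 1 * s)) * indicator {0..L'} (-L + 1 * s) \<partial>lborel)
      = (\<integral>\<^sup>+s\<in>{0..L'}. g (\<sigma>' s) \<partial>lborel)"
    using nn_integral_real_affine[OF meas', of 1 "-L"] by simp
  also have "(\<integral>\<^sup>+s\<in>{0..L}. g (\<sigma> s) \<partial>lborel) + (\<integral>\<^sup>+s\<in>{0..L'}. g (\<sigma>' s) \<partial>lborel) \<le> ennreal (r + r')"
    using add_mono[OF int int'] r r' by simp
  finally have "(\<integral>\<^sup>+s\<in>{0..L + L'}. g (\<tau> s) \<partial>lborel) \<le> ennreal (r + r')" .
  moreover have "\<tau> 0 = x" "\<tau> (L + L') = z"
    using L L' xy xy' by (auto simp: \<tau>_def)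
  ultimately show ?thesis
    unfolding arc_le_def using lip\<tau> L L' r r'
    by (intro conjI exI[of _ "L + L'"] exI[of _ \<tau>]) auto
qed

lemma dist_le_if_arc_le:
  fixes g :: "'a::metric_space \<Rightarrow> ennreal"
  assumes g: "g \<in> borel_measurable borel"
    and u: "\<And>x y. ennreal \<bar>u x - u y\<bar> \<le> ennreal (dist x y) * (g x + g y)"
    and "arc_le g x y r" and fin: "g x < \<infinity>" "g y < \<infinity>"
  shows "\<bar>u x - u y\<bar> \<le> 4 * r"
proof -
  obtain L :: real and \<sigma> :: "real \<Rightarrow> 'a" where r: "0 \<le> r" and L: "0 \<le> L" and lip: "1-lipschitz_on {0..L} \<sigma>"
    and xy: "\<sigma> 0 = x" "\<sigma> L = y" and int: "(\<integral>\<^sup>+s\<in>{0..L}. g (\<sigma> s) \<partial>lborel) \<le> ennreal r"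
    using assms(3) by (rule arc_leE)
  \<comment> \<open>The cut-off makes \<open>?h\<close> Borel on the whole line, as the interval
    estimate requires, without changing it on \<open>{0..L}\<close>.\<close>
  let ?h = "\<lambda>s. g (\<sigma> s) * indicator {0..L} s"
  have "ennreal \<bar>u (\<sigma> 0) - u (\<sigma> L)\<bar> \<le> 4 * (\<integral>\<^sup>+s\<in>{0..L}. ?h s \<partial>lborel)"
  proof (rule dist_le_nn_integral_if_hajlasz[OF L borel_measurable_comp_lipschitz[OF g lip]])
    fix s t assume st: "s \<in> {0..L}" "t \<in> {0..L}"
    have "ennreal \<bar>u (\<sigma> s) - u (\<sigma> t)\<bar> \<le> ennreal (dist (\<sigma> s) (\<sigma> t)) * (g (\<sigma> s) + g (\<sigma> t))"
      by (rule u)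
    also have "\<dots> \<le> ennreal \<bar>s - t\<bar> * (g (\<sigma> s) + g (\<sigma> t))"
      using lipschitz_onD[OF lip st] by (intro mult_right_mono ennreal_leI) (auto simp: dist_real_def)
    finally show "ennreal \<bar>u (\<sigma> s) - u (\<sigma> t)\<bar> \<le> ennreal \<bar>s - t\<bar> * (?h s + ?h t)"
      using st by simp
  qed (use L xy fin in auto)
  also have "(\<integral>\<^sup>+s\<in>{0..L}. ?h s \<partial>lborel) = (\<integral>\<^sup>+s\<in>{0..L}. g (\<sigma> s) \<partial>lborel)"
    by (intro nn_integral_cong) (auto simp: indicator_def)
  also have "4 * \<dots> \<le> 4 * ennreal r" using int by (intro mult_left_mono) auto
  also have "\<dots> = ennreal (4 * r)" using r by (simp add: ennreal_mult)
  finally show ?thesis using r xy by (subst (asm) ennreal_le_iff) auto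
qed

lemma arc_le_rectifiable_curve:
  assumes "rectifiable_curve \<gamma> a b" and "curve_integral g \<gamma> a b \<le> ennreal r" "0 \<le> r"
  shows "arc_le g (\<gamma> a) (\<gamma> b) r"
  unfolding arc_le_def
  using assms rectifiable_curve_arclength_param[OF assms(1)]
  by (intro conjI exI[of _ "enn2real (curve_length \<gamma> a b)"] exI[of _ "arclength_param \<gamma> a b"])
    (auto simp: curve_integral_def)

theorem upper_gradient_if_pointwise_hajlasz:
  fixes g :: "'a::metric_space \<Rightarrow> ennreal" and u :: "'a \<Rightarrow> real"
  assumes g[measurable]: "g \<in> borel_measurable borel"
    and u: "\<And>x y. ennreal \<bar>u x - u y\<bar> \<le> ennreal (dist x y) * (g x + g y)"
  obtains v where "\<And>x. g x < \<infinity> \<Longrightarrow> v x = u x" and "upper_gradient (\<lambda>x. 4 * g x) v"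
proof -
  \<comment> \<open>Rescaling absorbs the factor 4 of \<open>dist_le_if_arc_le\<close>, so
    \<open>u\<close> becomes 1-Lipschitz for \<open>?P\<close>.\<close>
  let ?P = "\<lambda>x y r. arc_le g x y (r / 4)"
  obtain v where v: "\<And>x. x \<in> {x. g x < \<infinity>} \<Longrightarrow> v x = u x"
    and le: "\<And>x y r. ?P x y r \<Longrightarrow> \<bar>v x - v y\<bar> \<le> r"
  proof (rule mcshane_extension[where P = ?P and u = u and G = "{x. g x < \<infinity>}"])
    show "0 \<le> r" if "?P x y r" for x y r using that by (simp add: arc_le_def)
    show "?P x x 0" for x using arc_le_refl[of g x] by simp
    show "?P y x r" if "?P x y r" for x y r using arc_le_sym[OF g that] .
    show "?P x z (r + s)" if "?P x y r" "?P y z s" for x y z r s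
      using arc_le_trans[OF g that] by (simp add: add_divide_distrib)
    show "\<bar>u x - u y\<bar> \<le> r" if "x \<in> {x. g x < \<infinity>}" "y \<in> {x. g x < \<infinity>}" "?P x y r" for x y r
      using dist_le_if_arc_le[OF g u that(3)] that(1,2) by simp
  qed blast
  have "ennreal \<bar>v (\<gamma> a) - v (\<gamma> b)\<bar> \<le> curve_integral (\<lambda>x. 4 * g x) \<gamma> a b"
    if \<gamma>: "rectifiable_curve \<gamma> a b" for \<gamma> a b
  proof -
    let ?L = "enn2real (curve_length \<gamma> a b)"
    have "curve_integral (\<lambda>x. 4 * g x) \<gamma> a b =
        (\<integral>\<^sup>+s. 4 * (g (arclength_param \<gamma> a b s) * indicator {0..?L} s) \<partial>lborel)"
      by (simp add: curve_integral_def mult.assoc)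
    also have "\<dots> = 4 * curve_integral g \<gamma> a b"
      using borel_measurable_comp_lipschitz[OF g rectifiable_curve_arclength_param(1)[OF \<gamma>]]
      by (simp add: nn_integral_cmult curve_integral_def)
    finally have eq: "curve_integral (\<lambda>x. 4 * g x) \<gamma> a b = 4 * curve_integral g \<gamma> a b" .
    show ?thesis
    \<comment> \<open>A finite integral is itself an admissible \<open>r\<close>; an infinite one
      leaves nothing to prove.\<close>
    proof (cases "curve_integral g \<gamma> a b")
      case (real r)
      then have "\<bar>v (\<gamma> a) - v (\<gamma> b)\<bar> \<le> 4 * r"
        by (intro le) (simp add: arc_le_rectifiable_curve[OF \<gamma>])
      then have "ennreal \<bar>v (\<gamma> a) - v (\<gamma> b)\<bar> \<le> ennreal (4 * r)" by (rule ennreal_leI)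
      then show ?thesis unfolding eq real(2) using real(1) by (simp add: ennreal_mult)
    next
      case top
      then show ?thesis by (simp add: eq ennreal_mult_top)
    qed
  qed
  then have "upper_gradient (\<lambda>x. 4 * g x) v" by (simp add: upper_gradient_def)
  then show thesis by (rule that[rotated]) (use v in simp)
qed

section \<open>Borel representatives\<close>

context metric_measure_space
begin

lemma borel_null_superset:
  assumes "N \<in> null_sets M"
  obtains S where "S \<in> sets borel" "N \<subseteq> S" "S \<in> null_sets M"
proof -
  obtain S where S: "S \<in> sets borel" "N \<subseteq> S" "emeasure M S = outer_measure_of M N"
    using borel_regular by blast
  moreover have "outer_measure_of M N = 0" using assms by (simp add: null_sets_def)
  ultimately show thesis using that borel_subset by auto
qed

text \<open>The \<open>distr\<close> is the restriction of \<open>M\<close> to Borel sets. A bounded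
  set differs from a Borel hull of equal finite measure by a null set, which has a Borel null hull;
  balls exhaust the general case.\<close>

lemma sets_completion_distr_borel: "sets M \<subseteq> sets (completion (distr M borel (\<lambda>x. x)))"
proof
  let ?M0 = "distr M borel (\<lambda>x. x)"
  have id[measurable]: "(\<lambda>x. x) \<in> M \<rightarrow>\<^sub>M borel"
    using borel_subset by (auto simp: measurable_def space_eq_UNIV)
  have null: "N \<in> null_sets ?M0" if "N \<in> sets borel" "N \<in> null_sets M" for N
    using that by (simp add: null_sets_def emeasure_distr space_eq_UNIV)
  fix A assume A: "A \<in> sets M"
  have *: "A \<in> sets (completion ?M0)" if A: "A \<in> sets M" and "bounded A" for A
  proof -
    obtain S where S: "S \<in> sets borel" "A \<subseteq> S" "emeasure M S = outer_measure_of M A"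
      using borel_regular by blast
    have SM: "S \<in> sets M" using S(1) borel_subset by blast
    have eq: "emeasure M S = emeasure M A" using S(3) A by simp
    have "emeasure M A \<noteq> \<infinity>" using finite_on_bounded[OF A \<open>bounded A\<close>] by simp
    then have "emeasure M (S - A) = 0"
      using emeasure_Diff[of M A S] A S(2) SM eq by simp
    then have "S - A \<in> null_sets M" using A SM by (simp add: null_setsI)
    then obtain N where N: "N \<in> sets borel" "S - A \<subseteq> N" "N \<in> null_sets M"
      by (rule borel_null_superset)
    show ?thesis
    proof (rule sets_completionI)
      show "A = (S - N) \<union> (A \<inter> N)" using N(2) S(2) by auto
      show "N \<in> null_sets ?M0" using N by (intro null)
    qed (use S(1) N(1) in auto)
  qed
  \<comment> \<open>An arbitrary centre for the exhausting balls.\<close>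
  obtain x :: 'a where True by simp
  have "A = (\<Union>n::nat. A \<inter> ball x (real n))"
    using reals_Archimedean2 by (auto simp: ball_def)
  also have "\<dots> \<in> sets (completion ?M0)"
  proof (intro sets.countable_UN, rule image_subsetI, rule *)
    fix n
    show "A \<inter> ball x (real n) \<in> sets M"
      using A borel_subset by (intro sets.Int) auto
  qed (simp add: bounded_Int)
  finally show "A \<in> sets (completion ?M0)" .
qed

lemma borel_representative:
  fixes g :: "'a \<Rightarrow> ennreal"
  assumes "g \<in> borel_measurable M"
  obtains g' where "g' \<in> borel_measurable borel" "AE x in M. g x = g' x"
proof -
  let ?M0 = "distr M borel (\<lambda>x. x)"
  have id: "(\<lambda>x. x) \<in> M \<rightarrow>\<^sub>M borel"
    using borel_subset by (auto simp: measurable_def space_eq_UNIV)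
  have "g \<in> borel_measurable (completion ?M0)"
    using assms sets_completion_distr_borel by (auto simp: measurable_def space_eq_UNIV)
  from completion_ex_borel_measurable[OF this]
  obtain g' where g': "g' \<in> borel_measurable ?M0" "AE x in ?M0. g x = g' x" by blast
  then have "AE x in M. g x = g' x" using AE_distrD[OF id] by blast
  with g'(1) that show thesis by simp
qed

text \<open>Preimages under \<open>u\<close> and \<open>v\<close> differ by a null set, and
  \<open>M\<close> is complete.\<close>

lemma borel_measurable_if_AE_eq:
  fixes u v :: "'a \<Rightarrow> real"
  assumes u: "u \<in> borel_measurable M" and "AE x in M. v x = u x"
  shows "v \<in> borel_measurable M"
proof (rule measurableI)
  fix A :: "real set" assume "A \<in> sets borel"
  with u have "u -` A \<inter> space M \<in> sets M" by (rule measurable_sets)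
  moreover have "AE x in M. x \<in> u -` A \<inter> space M \<longleftrightarrow> x \<in> v -` A \<inter> space M"
    using assms(2) by eventually_elim simp
  ultimately show "v -` A \<inter> space M \<in> sets M"
    using in_sets_AE by blast
qed simp

lemma borel_pointwise_hajlasz_gradient:
  assumes "hajlasz_gradient M g u"
  obtains g' where "g' \<in> borel_measurable borel" "AE x in M. g' x = g x"
    "\<And>x y. ennreal \<bar>u x - u y\<bar> \<le> ennreal (dist x y) * (g' x + g' y)"
proof -
  obtain E where g: "g \<in> borel_measurable M" and E: "E \<in> null_sets M"
    and u: "\<And>x y. x \<notin> E \<Longrightarrow> y \<notin> E \<Longrightarrow> ennreal \<bar>u x - u y\<bar> \<le> ennreal (dist x y) * (g x + g y)"
    using assms unfolding hajlasz_gradient_def by auto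
  obtain g0 where g0[measurable]: "g0 \<in> borel_measurable borel" and eq: "AE x in M. g x = g0 x"
    using borel_representative[OF g] .
  obtain E' where E': "E' \<in> null_sets M" "{x. g x \<noteq> g0 x} \<subseteq> E'"
    using eq by (auto simp: eventually_ae_filter space_eq_UNIV)
  obtain N where N[measurable]: "N \<in> sets borel" and sub: "E \<union> E' \<subseteq> N" and null: "N \<in> null_sets M"
    using borel_null_superset[OF null_sets.Un[OF E E'(1)]] .
  define g' where "g' x = (if x \<in> N then \<infinity> else g0 x)" for x
  show thesis
  proof
    show "g' \<in> borel_measurable borel" unfolding g'_def by measurable
    show "AE x in M. g' x = g x"
      using AE_not_in[OF null] eq by eventually_elim (simp add: g'_def)
    \<comment> \<open>At a point of \<open>N\<close> the right side is infinite unless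
      \<open>x = y\<close>, when the left side is 0.\<close>
    fix x y
    show "ennreal \<bar>u x - u y\<bar> \<le> ennreal (dist x y) * (g' x + g' y)"
    proof (cases "x \<in> N \<or> y \<in> N")
      case True
      then show ?thesis
        by (cases "x = y") (auto simp: g'_def ennreal_mult_top)
    next
      case False
      then have "x \<notin> E" "y \<notin> E" "g x = g0 x" "g y = g0 y" "g' x = g0 x" "g' y = g0 y"
        using sub E'(2) by (auto simp: g'_def)
      then show ?thesis using u[of x y] by simp
    qed
  qed
qed

end

section \<open>Embeddings\<close>

locale metric_measure_lattice =
  metric_measure_space M + quasi_banach_function_lattice M B qn
  for M :: "'a::metric_space measure" and B :: "('a \<Rightarrow> real) set" and qn :: "('a \<Rightarrow> real) \<Rightarrow> real"
begin

section \<open>Gradient norms and constant functions\<close>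

lemma zero_upper_gradient_const:
  "(\<lambda>x. 0) \<in> upper_gradients M B (\<lambda>x. c)" "grad_norm qn (\<lambda>x. 0) = 0"
  using zero_mem qn_eq_0_iff[OF zero_mem]
  by (simp_all add: upper_gradients_def upper_gradient_def grad_mem_def grad_norm_def)

lemma grad_norm_nonneg: "grad_mem M B g \<Longrightarrow> 0 \<le> grad_norm qn g"
  by (simp add: grad_mem_def grad_norm_def qn_nonneg)

lemma hom_newton_norm_le: "g \<in> upper_gradients M B v \<Longrightarrow> hom_newton_norm M B qn v \<le> grad_norm qn g"
  unfolding hom_newton_norm_def
  by (rule cINF_lower) (auto simp: upper_gradients_def grad_norm_nonneg intro: bdd_belowI2[where m = 0])

lemma hom_newton_norm_const: "hom_newton_norm M B qn (\<lambda>x. c) = 0"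
proof (rule antisym)
  show "hom_newton_norm M B qn (\<lambda>x. c) \<le> 0"
    using hom_newton_norm_le[OF zero_upper_gradient_const(1)[of c]] by (simp add: zero_upper_gradient_const(2))
  show "0 \<le> hom_newton_norm M B qn (\<lambda>x. c)"
    unfolding hom_newton_norm_def using zero_upper_gradient_const(1)[of c]
    by (intro cINF_greatest) (auto simp: upper_gradients_def grad_norm_nonneg)
qed

lemma hom_hajlasz_norm_nonneg:
  "hajlasz_gradients M B u \<noteq> {} \<Longrightarrow> 0 \<le> hom_hajlasz_norm M B qn u"
  unfolding hom_hajlasz_norm_def
  by (intro cINF_greatest) (auto simp: hajlasz_gradients_def grad_norm_nonneg)

lemma hajlasz_gradients_normD:
  assumes "hajlasz_gradients M B u \<noteq> {}" "hom_hajlasz_norm M B qn u < c"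
  obtains g where "g \<in> hajlasz_gradients M B u" "grad_norm qn g < c"
proof -
  have "Inf (grad_norm qn ` hajlasz_gradients M B u) < c"
    using assms(2) by (simp add: hom_hajlasz_norm_def)
  from cInf_lessD[OF _ this] assms(1) that show thesis by blast
qed

text \<open>Geometric decay makes the series converge to some \<open>h\<close> in quasi-norm. As the
  terms are non-negative, \<open>h\<close> bounds the partial sums a.e., so the series converges
  pointwise.\<close>

lemma AE_tendsto_0_if_qn_le_power:
  obtains q :: real where "0 < q" and
    "\<And>F. (\<And>n. F n \<in> B) \<Longrightarrow> (\<And>n x. 0 \<le> F n x) \<Longrightarrow> (\<And>n. qn (F n) \<le> q ^ n) \<Longrightarrow>
      AE x in M. (\<lambda>n. F n x) \<longlonglongrightarrow> 0"
proof -
  obtain K where K: "1 \<le> K" and complete: "\<forall>F :: nat \<Rightarrow> 'a \<Rightarrow> real.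
      (\<forall>n. F n \<in> B) \<and> summable (\<lambda>n. K ^ n * qn (F n)) \<longrightarrow>
      (\<exists>h\<in>B. (\<lambda>n. qn (\<lambda>x. h x - (\<Sum>k<n. F k x))) \<longlonglongrightarrow> 0)"
    using quasi_triangle_riesz_fischer by (elim exE conjE)
  show thesis
  proof
    \<comment> \<open>This ratio cancels the weight \<open>K ^ n\<close> of the Riesz-Fischer axiom
      and leaves \<open>(1 / 2) ^ n\<close>.\<close>
    show "0 < 1 / (2 * K)" using K by simp
    fix F assume F: "\<And>n. F n \<in> B" and nonneg: "\<And>n x. 0 \<le> F n x" and le: "\<And>n. qn (F n) \<le> (1 / (2 * K)) ^ n"
    have "summable (\<lambda>n. K ^ n * qn (F n))"
    proof (rule summable_comparison_test'[of "\<lambda>n. (1 / 2) ^ n" 0])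
      fix n
      have "K ^ n * qn (F n) \<le> K ^ n * (1 / (2 * K)) ^ n"
        using K le by (intro mult_left_mono) auto
      also have "\<dots> = (1 / 2) ^ n" using K by (simp add: power_mult_distrib[symmetric])
      finally show "norm (K ^ n * qn (F n)) \<le> (1 / 2) ^ n"
        using K qn_nonneg[OF F] by simp
    qed (simp add: summable_geometric)
    then obtain h where h: "h \<in> B" and lim: "(\<lambda>n. qn (\<lambda>x. h x - (\<Sum>k<n. F k x))) \<longlonglongrightarrow> 0"
      using complete[THEN spec, of F] F by auto
    have S: "(\<lambda>x. \<Sum>k<n. F k x) \<in> B" for n
    proof (induction n)
      case (Suc n)
      then show ?case using add_mem[OF Suc F[of n]] by simp
    qed (simp add: zero_mem)
    have D: "(\<lambda>x. h x - (\<Sum>k<n. F k x)) \<in> B" for n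
      using add_mem[OF h scale_mem[OF S[of n], of "-1"]] by simp
    have "AE x in M. (\<Sum>k<n. F k x) \<le> h x" for n
    proof -
      \<comment> \<open>The excess of the \<open>n\<close>-th partial sum over \<open>h\<close>. It
        is dominated by the distance of \<open>h\<close> from every later partial sum, so its
        quasi-norm is 0.\<close>
      define f where "f x = max 0 ((\<Sum>k<n. F k x) - h x)" for x
      have f_meas: "f \<in> borel_measurable M"
        unfolding f_def using measurable[OF S] measurable[OF h]
        by (intro borel_measurable_max borel_measurable_diff) auto
      have f: "f \<in> B \<and> qn f \<le> qn (\<lambda>x. h x - (\<Sum>k<m. F k x))" if "n \<le> m" for m
      proof (rule lattice[OF D f_meas], rule AE_I2)
        fix x
        have "(\<Sum>k<n. F k x) \<le> (\<Sum>k<m. F k x)"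
          using that nonneg by (intro sum_mono2) auto
        then show "\<bar>f x\<bar> \<le> \<bar>h x - (\<Sum>k<m. F k x)\<bar>" by (auto simp: f_def)
      qed
      have "qn f \<le> 0"
        using lim by (rule LIMSEQ_le_const) (use f in blast)
      then have "AE x in M. f x = 0"
        using f[of n] qn_nonneg[of f] qn_eq_0_iff[of f] by auto
      then show ?thesis by eventually_elim (simp add: f_def max_def split: if_splits)
    qed
    then have "AE x in M. \<forall>n. (\<Sum>k<n. F k x) \<le> h x" by (simp add: AE_all_countable)
    then show "AE x in M. (\<lambda>n. F n x) \<longlonglongrightarrow> 0"
    proof eventually_elim
      case (elim x)
      then have "summable (\<lambda>n. F n x)"
        by (intro summableI_nonneg_bounded[of _ "h x"] nonneg) simp
      then show ?case by (rule summable_LIMSEQ_zero)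
    qed
  qed
qed

text \<open>Gradients with norms below \<open>q ^ n\<close> tend to 0 a.e., and the Hajlasz
  inequality passes to the limit.\<close>

lemma AE_const_if_hom_hajlasz_norm_eq_0:
  assumes ne: "hajlasz_gradients M B u \<noteq> {}" and "hom_hajlasz_norm M B qn u = 0"
  obtains c where "AE x in M. u x = c"
proof -
  obtain q where "0 < q" and crit: "\<And>F. (\<And>n. F n \<in> B) \<Longrightarrow> (\<And>n x. 0 \<le> F n x) \<Longrightarrow>
      (\<And>n. qn (F n) \<le> q ^ n) \<Longrightarrow> AE x in M. (\<lambda>n. F n x) \<longlonglongrightarrow> 0"
    using AE_tendsto_0_if_qn_le_power by blast
  have "\<exists>g. g \<in> hajlasz_gradients M B u \<and> grad_norm qn g < q ^ n" for n
    using hajlasz_gradients_normD[OF ne, of "q ^ n"] assms(2) \<open>0 < q\<close> by auto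
  then obtain g where g: "\<And>n. g n \<in> hajlasz_gradients M B u"
    and small: "\<And>n. grad_norm qn (g n) < q ^ n" by metis
  define F where "F n x = enn2real (g n x)" for n x
  have lim: "AE x in M. (\<lambda>n. F n x) \<longlonglongrightarrow> 0"
  proof (rule crit)
    show "F n \<in> B" for n using g[of n] by (simp add: F_def[abs_def] hajlasz_gradients_def grad_mem_def)
    show "qn (F n) \<le> q ^ n" for n using small[of n] by (simp add: F_def[abs_def] grad_norm_def)
  qed (simp add: F_def)
  have "\<exists>E\<in>null_sets M. \<forall>x\<in>-E. \<forall>y\<in>-E. ennreal \<bar>u x - u y\<bar> \<le> ennreal (dist x y) * (g n x + g n y)" for n
    using g[of n] by (auto simp: hajlasz_gradients_def hajlasz_gradient_def)
  then obtain E where E: "\<And>n. E n \<in> null_sets M"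
    and haj: "\<And>n x y. x \<notin> E n \<Longrightarrow> y \<notin> E n \<Longrightarrow>
      ennreal \<bar>u x - u y\<bar> \<le> ennreal (dist x y) * (g n x + g n y)"
    by (metis ComplI)
  \<comment> \<open>The points good for all \<open>n\<close> at once; only countably many null sets
    are discarded.\<close>
  define P where "P x \<longleftrightarrow> (\<lambda>n. F n x) \<longlonglongrightarrow> 0 \<and> (\<forall>n. x \<notin> E n \<and> g n x < \<infinity>)" for x
  have "AE x in M. x \<notin> E n \<and> g n x < \<infinity>" for n
    using AE_not_in[OF E[of n]] g[of n] by (auto simp: hajlasz_gradients_def grad_mem_def)
  then have "AE x in M. \<forall>n. x \<notin> E n \<and> g n x < \<infinity>" by (simp only: AE_all_countable) blast
  with lim have AE_P: "AE x in M. P x" by eventually_elim (simp add: P_def)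
  have eq: "u x = u y" if "P x" "P y" for x y
  proof -
    have "\<bar>u x - u y\<bar> \<le> dist x y * (F n x + F n y)" for n
    proof -
      have fin: "g n x = ennreal (F n x)" "g n y = ennreal (F n y)"
        using that by (auto simp: P_def F_def)
      have "ennreal \<bar>u x - u y\<bar> \<le> ennreal (dist x y) * (g n x + g n y)"
        using that haj by (simp add: P_def)
      also have "\<dots> = ennreal (dist x y * (F n x + F n y))"
        unfolding fin by (simp add: F_def ennreal_mult ennreal_plus)
      finally show ?thesis by (subst (asm) ennreal_le_iff) (auto simp: F_def)
    qed
    moreover have "(\<lambda>n. dist x y * (F n x + F n y)) \<longlonglongrightarrow> dist x y * (0 + 0)"
      using that by (intro tendsto_mult tendsto_add tendsto_const) (auto simp: P_def)
    ultimately have "\<bar>u x - u y\<bar> \<le> dist x y * (0 + 0)"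
      by (intro LIMSEQ_le_const) auto
    then show ?thesis by simp
  qed
  \<comment> \<open>A nonzero measure leaves a good point, whose value of \<open>u\<close> serves as
    the constant.\<close>
  have "\<exists>x. P x"
  proof (rule ccontr)
    assume "\<nexists>x. P x"
    with AE_P have "AE x in M. False" by simp
    then show False using nontrivial by (simp add: AE_iff_null_sets space_eq_UNIV null_sets_def)
  qed
  then obtain x0 where "P x0" ..
  from AE_P have "AE x in M. u x = u x0" by eventually_elim (rule eq[OF _ \<open>P x0\<close>])
  then show thesis by (rule that)
qed

text \<open>The pointwise extension applies to a Borel version \<open>g'\<close> of
  \<open>g\<close>. Since \<open>g'\<close> is finite a.e., the extension agrees with
  \<open>u\<close> a.e., and the lattice property puts \<open>4 * g'\<close> into
  \<open>B\<close>.\<close>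

lemma newtonian_representative_of_gradient:
  assumes g: "g \<in> hajlasz_gradients M B u"
  obtains v where "AE x in M. v x = u x" "upper_gradients M B v \<noteq> {}"
    "hom_newton_norm M B qn v \<le> 4 * grad_norm qn g"
proof -
  have haj: "hajlasz_gradient M g u" and fin: "AE x in M. g x < \<infinity>"
    and gB: "(\<lambda>x. enn2real (g x)) \<in> B"
    using g by (auto simp: hajlasz_gradients_def grad_mem_def)
  obtain g' where g'[measurable]: "g' \<in> borel_measurable borel" and eq: "AE x in M. g' x = g x"
    and u: "\<And>x y. ennreal \<bar>u x - u y\<bar> \<le> ennreal (dist x y) * (g' x + g' y)"
    by (rule borel_pointwise_hajlasz_gradient[OF haj]) (rule that)
  obtain v where v: "\<And>x. g' x < \<infinity> \<Longrightarrow> v x = u x" and ug: "upper_gradient (\<lambda>x. 4 * g' x) v"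
    by (rule upper_gradient_if_pointwise_hajlasz[OF g' u]) (rule that)
  have g'_M: "g' \<in> borel_measurable M"
    using g' borel_subset by (auto simp: measurable_def space_eq_UNIV)
  have "AE x in M. \<bar>enn2real (4 * g' x)\<bar> \<le> \<bar>4 * enn2real (g x)\<bar>"
    using eq by eventually_elim (simp add: enn2real_mult)
  moreover have "(\<lambda>x. enn2real (4 * g' x)) \<in> borel_measurable M"
    using g'_M by simp
  ultimately have B: "(\<lambda>x. enn2real (4 * g' x)) \<in> B"
    and norm: "qn (\<lambda>x. enn2real (4 * g' x)) \<le> qn (\<lambda>x. 4 * enn2real (g x))"
    using lattice[OF scale_mem[OF gB, of 4]] by blast+
  have "AE x in M. 4 * g' x < \<infinity>"
    using eq fin by eventually_elim (simp add: ennreal_mult_less_top)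
  with B ug have mem: "(\<lambda>x. 4 * g' x) \<in> upper_gradients M B v"
    by (simp add: upper_gradients_def grad_mem_def)
  show thesis
  proof
    show "AE x in M. v x = u x"
      using eq fin by eventually_elim (simp add: v)
    show "upper_gradients M B v \<noteq> {}" using mem by blast
    have "hom_newton_norm M B qn v \<le> qn (\<lambda>x. 4 * enn2real (g x))"
      using hom_newton_norm_le[OF mem] norm by (simp add: grad_norm_def)
    also have "\<dots> = 4 * grad_norm qn g" using qn_scale[OF gB, of 4] by (simp add: grad_norm_def)
    finally show "hom_newton_norm M B qn v \<le> 4 * grad_norm qn g" .
  qed
qed

text \<open>
  The representative depends on the gradient, so when the infimum is \<open>0\<close> it cannot be approached
  with a single representative; but then \<open>u\<close> is constant a.e.
\<close>

lemma newtonian_representative: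
  assumes ne: "hajlasz_gradients M B u \<noteq> {}"
  obtains v where "AE x in M. v x = u x" "upper_gradients M B v \<noteq> {}"
    "hom_newton_norm M B qn v \<le> 8 * hom_hajlasz_norm M B qn u"
proof (cases "hom_hajlasz_norm M B qn u = 0")
  case True
  then obtain c where "AE x in M. u x = c"
    using AE_const_if_hom_hajlasz_norm_eq_0[OF ne] by blast
  then have "AE x in M. c = u x" by eventually_elim simp
  with True that[of "\<lambda>x. c"] zero_upper_gradient_const(1)[of c] show thesis
    by (auto simp: hom_newton_norm_const)
next
  case False
  \<comment> \<open>For a positive infimum some gradient has norm below twice it; with the factor 4
    of the extension this gives 8.\<close>
  then have "hom_hajlasz_norm M B qn u < 2 * hom_hajlasz_norm M B qn u"
    using hom_hajlasz_norm_nonneg[OF ne] by simp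
  then obtain g where g: "g \<in> hajlasz_gradients M B u"
    and less: "grad_norm qn g < 2 * hom_hajlasz_norm M B qn u"
    using hajlasz_gradients_normD[OF ne] by blast
  obtain v where "AE x in M. v x = u x" "upper_gradients M B v \<noteq> {}"
    "hom_newton_norm M B qn v \<le> 4 * grad_norm qn g"
    using newtonian_representative_of_gradient[OF g] .
  with less that[of v] show thesis by simp
qed

section \<open>Passage to the quotient spaces and the embeddings\<close>

lemma mem_newton_space:
  assumes "v \<in> pre_newton_space M B"
  shows "\<exists>U\<in>newton_space M B qn. v \<in> U"
proof -
  have "(v, v) \<in> newton_rel M B qn"
    using assms qn_eq_0_iff[OF zero_mem] hom_newton_norm_const[of 0]
    by (simp add: newton_rel_def newton_norm_def)
  with assms show ?thesis
    unfolding newton_space_def by (intro bexI[of _ "newton_rel M B qn `` {v}"]) (auto intro: quotientI)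
qed

lemma mem_hom_newton_space:
  assumes "v \<in> hom_pre_newton_space M B"
  shows "\<exists>U\<in>hom_newton_space M B qn. v \<in> U"
proof -
  have "(v, v) \<in> hom_newton_rel M B qn"
    using assms hom_newton_norm_const[of 0] by (simp add: hom_newton_rel_def)
  with assms show ?thesis
    unfolding hom_newton_space_def
    by (intro bexI[of _ "hom_newton_rel M B qn `` {v}"]) (auto intro: quotientI)
qed

lemma locally_integrable_AE_cong:
  assumes u: "u \<in> locally_integrable M" and eq: "AE x in M. v x = u x"
  shows "v \<in> locally_integrable M"
proof -
  have v: "v \<in> borel_measurable M"
    using borel_measurable_if_AE_eq[OF _ eq] u by (simp add: locally_integrable_def)
  have "set_integrable M (ball x r) v" if "set_integrable M (ball x r) u" for x r
  proof -
    have "AE y in M. indicator (ball x r) y *\<^sub>R u y = indicator (ball x r) y *\<^sub>R v y"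
      using eq by eventually_elim simp
    moreover have "(\<lambda>y. indicator (ball x r) y *\<^sub>R v y) \<in> borel_measurable M"
      using v borel_subset by (intro borel_measurable_scaleR borel_measurable_indicator) auto
    ultimately show ?thesis
      using integrable_cong_AE_imp[OF that[unfolded set_integrable_def]]
      unfolding set_integrable_def by blast
  qed
  with u v show ?thesis unfolding locally_integrable_def by blast
qed

lemma hajlasz_embeds_newton:
  assumes "u \<in> hajlasz_space M B"
  shows "\<exists>U\<in>newton_space M B qn. \<exists>v\<in>U. (AE x in M. v x = u x) \<and>
    newton_norm M B qn v \<le> 8 * hajlasz_norm M B qn u"
proof -
  have u: "u \<in> B" and ne: "hajlasz_gradients M B u \<noteq> {}"
    using assms by (auto simp: hajlasz_space_def)
  obtain v where v: "AE x in M. v x = u x" "upper_gradients M B v \<noteq> {}"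
    "hom_newton_norm M B qn v \<le> 8 * hom_hajlasz_norm M B qn u"
    using newtonian_representative[OF ne] .
  \<comment> \<open>Lets the lattice property transfer membership and quasi-norm from
    \<open>u\<close> to \<open>v\<close>.\<close>
  have "AE x in M. \<bar>v x\<bar> \<le> \<bar>u x\<bar>" using v(1) by eventually_elim simp
  then have vB: "v \<in> B" and le: "qn v \<le> qn u"
    using lattice[OF u] borel_measurable_if_AE_eq[OF measurable[OF u] v(1)] by blast+
  obtain U where "U \<in> newton_space M B qn" "v \<in> U"
    using mem_newton_space vB v(2) by (auto simp: pre_newton_space_def)
  \<comment> \<open>The first summand needs only the constant 1, which 8 covers because
    \<open>qn u\<close> is non-negative.\<close>
  moreover have "newton_norm M B qn v \<le> 8 * hajlasz_norm M B qn u"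
    using v(3) le qn_nonneg[OF u] by (simp add: newton_norm_def hajlasz_norm_def)
  ultimately show ?thesis using v(1) by blast
qed

lemma hom_hajlasz_embeds_hom_newton:
  assumes "u \<in> hom_hajlasz_space M B"
  shows "\<exists>U\<in>hom_newton_space M B qn. \<exists>v\<in>U. (AE x in M. v x = u x) \<and>
    hom_newton_norm M B qn v \<le> 8 * hom_hajlasz_norm M B qn u"
proof -
  have u: "u \<in> locally_integrable M" and ne: "hajlasz_gradients M B u \<noteq> {}"
    using assms by (auto simp: hom_hajlasz_space_def)
  obtain v where v: "AE x in M. v x = u x" "upper_gradients M B v \<noteq> {}"
    "hom_newton_norm M B qn v \<le> 8 * hom_hajlasz_norm M B qn u"
    using newtonian_representative[OF ne] .
  obtain U where "U \<in> hom_newton_space M B qn" "v \<in> U"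
    using mem_hom_newton_space locally_integrable_AE_cong[OF u v(1)] v(2)
    by (auto simp: hom_pre_newton_space_def)
  then show ?thesis using v by blast
qed

end

theorem theorem4p3:
  fixes M :: "'a::metric_space measure"
    and B :: "('a \<Rightarrow> real) set"
    and qn :: "('a \<Rightarrow> real) \<Rightarrow> real"
  assumes "metric_measure_space M"
    and "quasi_banach_function_lattice M B qn"
    and "B \<subseteq> locally_integrable M"
  shows "(\<exists>C>0. \<forall>u\<in>hajlasz_space M B. \<exists>U\<in>newton_space M B qn. \<exists>v\<in>U.
            (AE x in M. v x = u x) \<and> newton_norm M B qn v \<le> C * hajlasz_norm M B qn u) \<and>
         (\<exists>C>0. \<forall>u\<in>hom_hajlasz_space M B. \<exists>U\<in>hom_newton_space M B qn. \<exists>v\<in>U.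
            (AE x in M. v x = u x) \<and> hom_newton_norm M B qn v \<le> C * hom_hajlasz_norm M B qn u)"
proof -
  interpret metric_measure_lattice M B qn
    using assms(1,2) by (rule metric_measure_lattice.intro)
  show ?thesis
    by (intro conjI exI[of _ 8] ballI hajlasz_embeds_newton hom_hajlasz_embeds_hom_newton) simp_all
qed

end
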